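(* Let $(G_n)_{n\ge1}$ be a sequence of triangle-free graphs with $|V(G_n)|\to\infty$ such that for every finite graph $H$ the limit $\phi(H)=\lim_{n\to\infty}p(H,G_n)$ exists, and suppose $\phi(C_5)=\frac{5!}{5^5}$. Then $\phi=\phi_{C_5}$, i.e. for every finite graph $H$, $\phi(H)=\lim_{k\to\infty}p(H,C_5^{(k)})$. In other words, $\phi_{C_5}$ is the unique element $\phi\in\mathrm{Hom}^+(\mathcal A^0[T_{\mathrm{TF\text{-}Graph}}],\mathbb R)$ with $\phi(C_5)=5!/5^5$.
   Context: $p(H,G)$ is the induced density of $H$ in $G$: the probability that the subgraph induced on a uniformly random $|V(H)|$-subset of $V(G)$ is isomorphic to $H$. $C_5$ is the cycle of length five. For a graph $G$ and positive integer $k$, the balanced blow-up $G^{(k)}$ has vertex set $V(G)\times[k]$, with $(v,i)$ adjacent to $(w,j)$ iff $v\ne w$ and $vw\in E(G)$. For a finite graph $G$, $\phi_G$ denotes the functional $H\mapsto\lim_{k\to\infty}p(H,G^{(k)})$ (this limit exists). $\mathrm{Hom}^+(\mathcal A^0[T_{\mathrm{TF\text{-}Graph}}],\mathbb R)$ is the set of functionals $H\mapsto\lim_n p(H,G_n)$ arising from sequences of triangle-free graphs as in the claim (positive homomorphisms of the flag algebra of triangle-free graphs). *)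

theory Defs
  imports
    Complex_Main
    "HOL-Library.FuncSet"
    "Graph_Theory.Pair_Digraph"
    "Graph_Theory.Digraph_Component"
    "Graph_Theory.Digraph_Isomorphism"
begin

text \<open>
  Finite simple graphs are records satisfying \<^locale>\<open>pair_graph\<close>: finite vertex set, and an
  edge \<open>uv\<close> is represented by the two arcs \<open>(u, v)\<close> and \<open>(v, u)\<close>.  Every finite graph is
  isomorphic to one with vertices in \<^typ>\<open>nat\<close>, so functionals on finite graphs are taken to be
  functions on \<^typ>\<open>nat pair_pre_digraph\<close>, of which only the values on \<^locale>\<open>pair_graph\<close>s
  are meaningful.
\<close>

definition triangle_free :: "'a pair_pre_digraph \<Rightarrow> bool" where
  "triangle_free G \<longleftrightarrow>
     \<not> (\<exists>u v w. (u, v) \<in> parcs G \<and> (v, w) \<in> parcs G \<and> (w, u) \<in> parcs G)"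

text \<open>
  The uniform probability that a set of \<open>|V(H)|\<close> vertices of \<open>G\<close> induces a copy of \<open>H\<close>.
  By \<open>x / 0 = 0\<close> it is \<open>0\<close> if \<open>H\<close> has more vertices than \<open>G\<close>.
\<close>
definition induced_density :: "'b pair_pre_digraph \<Rightarrow> 'a pair_pre_digraph \<Rightarrow> real" where
  "induced_density H G =
     real (card {S. S \<subseteq> pverts G \<and> card S = card (pverts H) \<and>
                    digraph_iso (with_proj G \<restriction> S) (with_proj H)}) /
     real (card {S. S \<subseteq> pverts G \<and> card S = card (pverts H)})"

definition cycle5 :: "nat pair_pre_digraph" where
  "cycle5 = \<lparr> pverts = {..<5},
     parcs = {(i, j). i < 5 \<and> j < 5 \<and> (j = (i + 1) mod 5 \<or> i = (j + 1) mod 5)} \<rparr>"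

definition blowup :: "'a pair_pre_digraph \<Rightarrow> nat \<Rightarrow> ('a \<times> nat) pair_pre_digraph" where
  "blowup G k = \<lparr> pverts = pverts G \<times> {1..k},
     parcs = {((v, i), (w, j)) | v i w j.
                i \<in> {1..k} \<and> j \<in> {1..k} \<and> v \<noteq> w \<and> (v, w) \<in> parcs G} \<rparr>"

definition tf_converges_to ::
    "(nat \<Rightarrow> 'a pair_pre_digraph) \<Rightarrow> (nat pair_pre_digraph \<Rightarrow> real) \<Rightarrow> bool" where
  "tf_converges_to G \<phi> \<longleftrightarrow>
     (\<forall>n. pair_graph (G n) \<and> triangle_free (G n)) \<and>
     filterlim (\<lambda>n. card (pverts (G n))) at_top sequentially \<and>
     (\<forall>H. pair_graph H \<longrightarrow> (\<lambda>n. induced_density H (G n)) \<longlonglongrightarrow> \<phi> H)"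

text \<open>
  Functionals are made \<^const>\<open>undefined\<close> on records that are not graphs, so that equality of
  functionals is equality on all finite graphs.
\<close>
definition tf_hom_plus :: "(nat pair_pre_digraph \<Rightarrow> real) set" where
  "tf_hom_plus =
     {\<phi> \<in> extensional (Collect pair_graph).
        \<exists>G :: nat \<Rightarrow> nat pair_pre_digraph. tf_converges_to G \<phi>}"

definition blowup_limit :: "'a pair_pre_digraph \<Rightarrow> nat pair_pre_digraph \<Rightarrow> real" where
  "blowup_limit G =
     restrict (\<lambda>H. lim (\<lambda>k. induced_density H (blowup G k))) (Collect pair_graph)"

end

theory Submission
  imports Defs
begin

text \<open>
  The upper bound on pentagons is a flag algebra certificate.  Summed over all 5-tuples of vertices
  of a triangle-free graph, the indicator of a pentagon, the indicator of an induced path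
  \<open>x\<^sub>0x\<^sub>1x\<^sub>2x\<^sub>3\<close> with a fifth vertex not adjacent to \<open>x\<^sub>0, x\<^sub>1, x\<^sub>2\<close>, and a positive semidefinite
  quadratic form in the neighbourhood types over each triple of vertices add up to at most a
  constant: after averaging over the permutations of the 5-tuple this holds pointwise.

  The second indicator is the slack that yields uniqueness.  A vertex with at most one neighbour on
  a pentagon produces such a 5-tuple.  So if the pentagon density is asymptotically extremal, some
  pentagon has only \<open>o(n)\<close> vertices that are not adjacent to two of its vertices, and the position of
  these two neighbours splits the other vertices into five classes with edges only between
  cyclically consecutive classes.  Counting pentagons again shows that the classes have size
  \<open>n/5 + o(n)\<close> and that only \<open>o(n\<^sup>2)\<close> pairs between consecutive classes are missing, hence all induced
  densities converge to those of the blow-ups of the pentagon.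
\<close>

section \<open>The certificate\<close>

text \<open>The pentagon has ten automorphisms, so the density 5!/5^5 means 10 (n/5)^5 = (2/625) n^5
  labelled pentagons up to lower order. All counting is done with labelled maps, and tuples with
  repeated vertices are kept in the certificate: the inequality then holds exactly in every finite
  triangle-free graph, and limits are taken afterwards.

  The certificate controls only patterns on five vertices, while uniqueness needs a global
  partition. One pentagon provides it: there are at most 5n times as many pairs of a pentagon and a
  badly attached vertex as there are bad 5-tuples, so averaging finds a pentagon with few such
  vertices. The other vertices are coloured with no surplus edge at all, since adjacent vertices of
  a triangle-free graph have no common neighbour.

  Missing edges and unequal classes are detected by the same count: a pentagon that avoids the
  exceptional vertices takes one vertex from each class and one edge from each consecutive pair of
  classes, so either defect costs a positive proportion of the maximum 10 (n/5)^5.\<close>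

type_synonym 'r edge_function =
  "bool \<Rightarrow> bool \<Rightarrow> bool \<Rightarrow> bool \<Rightarrow> bool \<Rightarrow> bool \<Rightarrow> bool \<Rightarrow> bool \<Rightarrow> bool \<Rightarrow> bool \<Rightarrow> 'r"

type_synonym neighbourhood_form = "bool \<Rightarrow> bool \<Rightarrow> bool \<Rightarrow> int"

text \<open>
  The forms below describe how a vertex \<open>w\<close> is attached to a triple \<open>u, v, t\<close> that induces no edge,
  the single edge \<open>uv\<close>, or the path \<open>utv\<close>; the arguments say whether \<open>w\<close> is adjacent to \<open>u\<close>, \<open>v\<close>, \<open>t\<close>.
  In a balanced blow-up of the pentagon each form sums to \<open>0\<close> over all \<open>w\<close>, which is necessary for
  the certificate to be tight there.  The coefficients in \<open>type_square\<close> are a rounded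
  numerical solution of the resulting semidefinite program.
\<close>

fun empty_form1 :: neighbourhood_form where
  "empty_form1 True False False = -1"
| "empty_form1 False True False = -1"
| "empty_form1 False False True = -1"
| "empty_form1 True True False = 1"
| "empty_form1 True False True = 1"
| "empty_form1 False True True = 1"
| "empty_form1 _ _ _ = 0"

fun empty_form2 :: neighbourhood_form where
  "empty_form2 False False False = -2"
| "empty_form2 True False False = 1"
| "empty_form2 False True False = 1"
| "empty_form2 False False True = 1"
| "empty_form2 True True True = 3"
| "empty_form2 _ _ _ = 0"

fun edge_form1 :: neighbourhood_form where
  "edge_form1 False False True = 1"
| "edge_form1 _ _ _ = 0"

fun edge_form2 :: neighbourhood_form where
  "edge_form2 False False False = -2"
| "edge_form2 True False False = 1"
| "edge_form2 False True False = 1"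
| "edge_form2 _ _ _ = 0"

fun edge_form3 :: neighbourhood_form where
  "edge_form3 False False False = -2"
| "edge_form3 True False True = 1"
| "edge_form3 False True True = 1"
| "edge_form3 _ _ _ = 0"

fun edge_form4 :: neighbourhood_form where
  "edge_form4 True False True = 1"
| "edge_form4 False True True = -1"
| "edge_form4 _ _ _ = 0"

fun path_form1 :: neighbourhood_form where
  "path_form1 False False False = 2"
| "path_form1 False False True = -1"
| "path_form1 True False False = 1"
| "path_form1 False True False = 1"
| "path_form1 _ _ _ = 0"

fun path_form2 :: neighbourhood_form where
  "path_form2 False False False = -2"
| "path_form2 False False True = -1"
| "path_form2 True True False = 2"
| "path_form2 _ _ _ = 0"

fun path_form3 :: neighbourhood_form where
  "path_form3 True False False = 1"
| "path_form3 False True False = -1"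
| "path_form3 _ _ _ = 0"

text \<open>Each type is weighted in one placement only, the edge on \<open>uv\<close> and the path
  with centre \<open>t\<close>; symmetrisation supplies the others. Whether \<open>w\<close> and
  \<open>x\<close> are adjacent is not an argument, so for a fixed triple the sum over
  \<open>w\<close> and \<open>x\<close> splits into products of single sums.\<close>

definition type_square ::
    "bool \<Rightarrow> bool \<Rightarrow> bool \<Rightarrow> bool \<Rightarrow> bool \<Rightarrow> bool \<Rightarrow> bool \<Rightarrow> bool \<Rightarrow> bool \<Rightarrow> int" where
  "type_square uv ut vt wu wv wt xu xv xt =
   (if ut then
      (if \<not> uv \<and> vt then
         219 * (path_form1 wu wv wt * path_form1 xu xv xt)
       - 93 * (path_form1 wu wv wt * path_form2 xu xv xt)
       + 66 * (path_form2 wu wv wt * path_form2 xu xv xt)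
       + 1878 * (path_form3 wu wv wt * path_form3 xu xv xt)
       else 0)
    else if vt then 0
    else if uv then
         1032 * (edge_form1 wu wv wt * edge_form1 xu xv xt)
       + 540 * (edge_form1 wu wv wt * edge_form3 xu xv xt)
       + 468 * (edge_form2 wu wv wt * edge_form2 xu xv xt)
       - 642 * (edge_form2 wu wv wt * edge_form3 xu xv xt)
       + 303 * (edge_form3 wu wv wt * edge_form3 xu xv xt)
       + 2250 * (edge_form4 wu wv wt * edge_form4 xu xv xt)
    else
         108 * (empty_form1 wu wv wt * empty_form1 xu xv xt)
       - 38 * (empty_form1 wu wv wt * empty_form2 xu xv xt)
       + 6 * (empty_form2 wu wv wt * empty_form2 xu xv xt))"

text \<open>The triple is x0, x1, x2 and the attached vertices are x3, x4. The weight 7500 makes the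
  bound 24 tight for 10 (n/5)^5 labelled pentagons, as 7500 * 10 / 5^5 = 24. Any positive weight on
  the second indicator gives slack; with 24 the deficit can be read off directly.\<close>

definition certificate :: "int edge_function" where
  "certificate a01 a02 a03 a04 a12 a13 a14 a23 a24 a34 =
     (if a01 \<and> a12 \<and> a23 then
        (if a34 \<and> a04 then 7500 else if a02 \<or> a13 \<or> a03 \<or> a04 \<or> a14 \<or> a24 then 0 else 24) else 0)
     + type_square a01 a02 a12 a03 a13 a23 a04 a14 a24"

text \<open>
  The argument \<open>aij\<close> says whether \<open>x\<^sub>i\<close> and \<open>x\<^sub>j\<close> are adjacent.  The \<open>k\<close>-th step sums over the
  transpositions \<open>(i k)\<close> with \<open>i < k\<close> and the identity, which represent the cosets of the symmetric
  group on \<open>0, \<dots>, k - 1\<close> in the one on \<open>0, \<dots>, k\<close>; so \<open>sym4\<close> sums over all 120 permutations of the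
  vertices.
\<close>

definition sym1 :: "int edge_function" where
  "sym1 a01 a02 a03 a04 a12 a13 a14 a23 a24 a34 =
     certificate a01 a02 a03 a04 a12 a13 a14 a23 a24 a34
   + certificate a01 a12 a13 a14 a02 a03 a04 a23 a24 a34"

definition sym2 :: "int edge_function" where
  "sym2 a01 a02 a03 a04 a12 a13 a14 a23 a24 a34 =
     sym1 a01 a02 a03 a04 a12 a13 a14 a23 a24 a34
   + sym1 a12 a02 a23 a24 a01 a13 a14 a03 a04 a34
   + sym1 a02 a01 a03 a04 a12 a23 a24 a13 a14 a34"

definition sym3 :: "int edge_function" where
  "sym3 a01 a02 a03 a04 a12 a13 a14 a23 a24 a34 =
     sym2 a01 a02 a03 a04 a12 a13 a14 a23 a24 a34
   + sym2 a13 a23 a03 a34 a12 a01 a14 a02 a24 a04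
   + sym2 a03 a02 a01 a04 a23 a13 a34 a12 a24 a14
   + sym2 a01 a03 a02 a04 a13 a12 a14 a23 a34 a24"

definition sym4 :: "int edge_function" where
  "sym4 a01 a02 a03 a04 a12 a13 a14 a23 a24 a34 =
     sym3 a01 a02 a03 a04 a12 a13 a14 a23 a24 a34
   + sym3 a14 a24 a34 a04 a12 a13 a01 a23 a02 a03
   + sym3 a04 a02 a03 a01 a24 a34 a14 a23 a12 a13
   + sym3 a01 a04 a03 a02 a14 a13 a12 a34 a24 a23
   + sym3 a01 a02 a04 a03 a12 a14 a13 a24 a23 a34"

definition triangle_free10 :: "bool edge_function" where
  "triangle_free10 a01 a02 a03 a04 a12 a13 a14 a23 a24 a34 \<longleftrightarrow>
     \<not> (a01 \<and> a02 \<and> a12) \<and> \<not> (a01 \<and> a03 \<and> a13) \<and> \<not> (a01 \<and> a04 \<and> a14) \<and>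
     \<not> (a02 \<and> a03 \<and> a23) \<and> \<not> (a02 \<and> a04 \<and> a24) \<and> \<not> (a03 \<and> a04 \<and> a34) \<and>
     \<not> (a12 \<and> a13 \<and> a23) \<and> \<not> (a12 \<and> a14 \<and> a24) \<and> \<not> (a13 \<and> a14 \<and> a34) \<and>
     \<not> (a23 \<and> a24 \<and> a34)"

text \<open>
  The conditional, unlike an implication, keeps \<open>code_simp\<close> from evaluating \<open>sym4\<close> on graphs with a
  triangle.
\<close>

definition certificate_check :: "bool list \<Rightarrow> bool" where
  "certificate_check b = (case b of
     [a01,a02,a03,a04,a12,a13,a14,a23,a24,a34] \<Rightarrow>
       if triangle_free10 a01 a02 a03 a04 a12 a13 a14 a23 a24 a34
       then sym4 a01 a02 a03 a04 a12 a13 a14 a23 a24 a34 \<le> 2880 else True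
   | _ \<Rightarrow> True)"

text \<open>A finite computation over all 2^10 edge patterns; the patterns of tuples with repeated
  vertices are among them.\<close>

lemma certificate_check_all: "list_all certificate_check (List.n_lists 10 [False, True])"
  by code_simp

lemma sym4_le:
  assumes "triangle_free10 a01 a02 a03 a04 a12 a13 a14 a23 a24 a34"
  shows "sym4 a01 a02 a03 a04 a12 a13 a14 a23 a24 a34 \<le> 2880"
proof -
  have "[a01,a02,a03,a04,a12,a13,a14,a23,a24,a34] \<in> set (List.n_lists 10 [False, True])"
    by (simp add: set_n_lists)
  then have "certificate_check [a01,a02,a03,a04,a12,a13,a14,a23,a24,a34]"
    using certificate_check_all by (simp only: list_all_iff)
  then show ?thesis
    using assms by (simp add: certificate_check_def)
qed

text \<open>Repetitions among the five vertices are allowed: only over the full product do the sums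
  over x3 and x4 become independent once x0, x1, x2 are fixed.\<close>

definition sum5 :: "'a set \<Rightarrow> ('a \<Rightarrow> 'a \<Rightarrow> bool) \<Rightarrow> int edge_function \<Rightarrow> int" where
  "sum5 V E F = (\<Sum>(x0,x1,x2,x3,x4)\<in>V \<times> V \<times> V \<times> V \<times> V.
     F (E x0 x1) (E x0 x2) (E x0 x3) (E x0 x4) (E x1 x2) (E x1 x3) (E x1 x4) (E x2 x3) (E x2 x4) (E x3 x4))"

lemma sum5_add:
  "sum5 V E (\<lambda>a01 a02 a03 a04 a12 a13 a14 a23 a24 a34.
     F a01 a02 a03 a04 a12 a13 a14 a23 a24 a34 + G a01 a02 a03 a04 a12 a13 a14 a23 a24 a34) =
   sum5 V E F + sum5 V E G"
  unfolding sum5_def by (simp add: case_prod_unfold sum.distrib)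

text \<open>Renaming two summation variables permutes the ten arguments; symmetry of
  \<open>E\<close> restores the order of the indices within each pair. The next nine lemmas do the
  same for the other transpositions that occur in \<open>sym2\<close>, \<open>sym3\<close> and
  \<open>sym4\<close>.\<close>

lemma sum5_swap01:
  assumes "\<And>x y. E x y = E y x"
  shows "sum5 V E (\<lambda>a01 a02 a03 a04 a12 a13 a14 a23 a24 a34.
    F a01 a12 a13 a14 a02 a03 a04 a23 a24 a34) = sum5 V E F"
  unfolding sum5_def
  by (rule sum.reindex_bij_witness[where
        i = "\<lambda>(x0,x1,x2,x3,x4). (x1,x0,x2,x3,x4)" and
        j = "\<lambda>(x0,x1,x2,x3,x4). (x1,x0,x2,x3,x4)"]) (auto simp: assms)

lemma sum5_swap02:
  assumes "\<And>x y. E x y = E y x"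
  shows "sum5 V E (\<lambda>a01 a02 a03 a04 a12 a13 a14 a23 a24 a34.
    F a12 a02 a23 a24 a01 a13 a14 a03 a04 a34) = sum5 V E F"
  unfolding sum5_def
  by (rule sum.reindex_bij_witness[where
        i = "\<lambda>(x0,x1,x2,x3,x4). (x2,x1,x0,x3,x4)" and
        j = "\<lambda>(x0,x1,x2,x3,x4). (x2,x1,x0,x3,x4)"]) (auto simp: assms)

lemma sum5_swap12:
  assumes "\<And>x y. E x y = E y x"
  shows "sum5 V E (\<lambda>a01 a02 a03 a04 a12 a13 a14 a23 a24 a34.
    F a02 a01 a03 a04 a12 a23 a24 a13 a14 a34) = sum5 V E F"
  unfolding sum5_def
  by (rule sum.reindex_bij_witness[where
        i = "\<lambda>(x0,x1,x2,x3,x4). (x0,x2,x1,x3,x4)" and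
        j = "\<lambda>(x0,x1,x2,x3,x4). (x0,x2,x1,x3,x4)"]) (auto simp: assms)

lemma sum5_swap03:
  assumes "\<And>x y. E x y = E y x"
  shows "sum5 V E (\<lambda>a01 a02 a03 a04 a12 a13 a14 a23 a24 a34.
    F a13 a23 a03 a34 a12 a01 a14 a02 a24 a04) = sum5 V E F"
  unfolding sum5_def
  by (rule sum.reindex_bij_witness[where
        i = "\<lambda>(x0,x1,x2,x3,x4). (x3,x1,x2,x0,x4)" and
        j = "\<lambda>(x0,x1,x2,x3,x4). (x3,x1,x2,x0,x4)"]) (auto simp: assms)

lemma sum5_swap13:
  assumes "\<And>x y. E x y = E y x"
  shows "sum5 V E (\<lambda>a01 a02 a03 a04 a12 a13 a14 a23 a24 a34.
    F a03 a02 a01 a04 a23 a13 a34 a12 a24 a14) = sum5 V E F"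
  unfolding sum5_def
  by (rule sum.reindex_bij_witness[where
        i = "\<lambda>(x0,x1,x2,x3,x4). (x0,x3,x2,x1,x4)" and
        j = "\<lambda>(x0,x1,x2,x3,x4). (x0,x3,x2,x1,x4)"]) (auto simp: assms)

lemma sum5_swap23:
  assumes "\<And>x y. E x y = E y x"
  shows "sum5 V E (\<lambda>a01 a02 a03 a04 a12 a13 a14 a23 a24 a34.
    F a01 a03 a02 a04 a13 a12 a14 a23 a34 a24) = sum5 V E F"
  unfolding sum5_def
  by (rule sum.reindex_bij_witness[where
        i = "\<lambda>(x0,x1,x2,x3,x4). (x0,x1,x3,x2,x4)" and
        j = "\<lambda>(x0,x1,x2,x3,x4). (x0,x1,x3,x2,x4)"]) (auto simp: assms)

lemma sum5_swap04:
  assumes "\<And>x y. E x y = E y x"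
  shows "sum5 V E (\<lambda>a01 a02 a03 a04 a12 a13 a14 a23 a24 a34.
    F a14 a24 a34 a04 a12 a13 a01 a23 a02 a03) = sum5 V E F"
  unfolding sum5_def
  by (rule sum.reindex_bij_witness[where
        i = "\<lambda>(x0,x1,x2,x3,x4). (x4,x1,x2,x3,x0)" and
        j = "\<lambda>(x0,x1,x2,x3,x4). (x4,x1,x2,x3,x0)"]) (auto simp: assms)

lemma sum5_swap14:
  assumes "\<And>x y. E x y = E y x"
  shows "sum5 V E (\<lambda>a01 a02 a03 a04 a12 a13 a14 a23 a24 a34.
    F a04 a02 a03 a01 a24 a34 a14 a23 a12 a13) = sum5 V E F"
  unfolding sum5_def
  by (rule sum.reindex_bij_witness[where
        i = "\<lambda>(x0,x1,x2,x3,x4). (x0,x4,x2,x3,x1)" and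
        j = "\<lambda>(x0,x1,x2,x3,x4). (x0,x4,x2,x3,x1)"]) (auto simp: assms)

lemma sum5_swap24:
  assumes "\<And>x y. E x y = E y x"
  shows "sum5 V E (\<lambda>a01 a02 a03 a04 a12 a13 a14 a23 a24 a34.
    F a01 a04 a03 a02 a14 a13 a12 a34 a24 a23) = sum5 V E F"
  unfolding sum5_def
  by (rule sum.reindex_bij_witness[where
        i = "\<lambda>(x0,x1,x2,x3,x4). (x0,x1,x4,x3,x2)" and
        j = "\<lambda>(x0,x1,x2,x3,x4). (x0,x1,x4,x3,x2)"]) (auto simp: assms)

lemma sum5_swap34:
  assumes "\<And>x y. E x y = E y x"
  shows "sum5 V E (\<lambda>a01 a02 a03 a04 a12 a13 a14 a23 a24 a34.
    F a01 a02 a04 a03 a12 a14 a13 a24 a23 a34) = sum5 V E F"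
  unfolding sum5_def
  by (rule sum.reindex_bij_witness[where
        i = "\<lambda>(x0,x1,x2,x3,x4). (x0,x1,x2,x4,x3)" and
        j = "\<lambda>(x0,x1,x2,x3,x4). (x0,x1,x2,x4,x3)"]) (auto simp: assms)

text \<open>Every coset representative contributes the same sum, so the four steps multiply it by 2,
  3, 4 and 5, in total by 120.\<close>

lemma sum5_sym1:
  assumes "\<And>x y. E x y = E y x"
  shows "sum5 V E sym1 = 2 * sum5 V E certificate"
proof -
  have eq: "sym1 = (\<lambda>a01 a02 a03 a04 a12 a13 a14 a23 a24 a34. certificate a01 a02 a03 a04 a12 a13 a14 a23 a24 a34
     + certificate a01 a12 a13 a14 a02 a03 a04 a23 a24 a34)"
    by (intro ext) (simp add: sym1_def)
  show ?thesis
    unfolding eq sum5_add sum5_swap01[of E V certificate, OF assms] by simp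
qed

lemma sum5_sym2:
  assumes "\<And>x y. E x y = E y x"
  shows "sum5 V E sym2 = 3 * sum5 V E sym1"
proof -
  have eq: "sym2 = (\<lambda>a01 a02 a03 a04 a12 a13 a14 a23 a24 a34. sym1 a01 a02 a03 a04 a12 a13 a14 a23 a24 a34
     + sym1 a12 a02 a23 a24 a01 a13 a14 a03 a04 a34
     + sym1 a02 a01 a03 a04 a12 a23 a24 a13 a14 a34)"
    by (intro ext) (simp add: sym2_def)
  show ?thesis
    unfolding eq sum5_add sum5_swap02[of E V sym1, OF assms] sum5_swap12[of E V sym1, OF assms] by simp
qed

lemma sum5_sym3:
  assumes "\<And>x y. E x y = E y x"
  shows "sum5 V E sym3 = 4 * sum5 V E sym2"
proof -
  have eq: "sym3 = (\<lambda>a01 a02 a03 a04 a12 a13 a14 a23 a24 a34. sym2 a01 a02 a03 a04 a12 a13 a14 a23 a24 a34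
     + sym2 a13 a23 a03 a34 a12 a01 a14 a02 a24 a04
     + sym2 a03 a02 a01 a04 a23 a13 a34 a12 a24 a14
     + sym2 a01 a03 a02 a04 a13 a12 a14 a23 a34 a24)"
    by (intro ext) (simp add: sym3_def)
  show ?thesis
    unfolding eq sum5_add sum5_swap03[of E V sym2, OF assms] sum5_swap13[of E V sym2, OF assms] sum5_swap23[of E V sym2, OF assms] by simp
qed

lemma sum5_sym4:
  assumes "\<And>x y. E x y = E y x"
  shows "sum5 V E sym4 = 5 * sum5 V E sym3"
proof -
  have eq: "sym4 = (\<lambda>a01 a02 a03 a04 a12 a13 a14 a23 a24 a34. sym3 a01 a02 a03 a04 a12 a13 a14 a23 a24 a34
     + sym3 a14 a24 a34 a04 a12 a13 a01 a23 a02 a03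
     + sym3 a04 a02 a03 a01 a24 a34 a14 a23 a12 a13
     + sym3 a01 a04 a03 a02 a14 a13 a12 a34 a24 a23
     + sym3 a01 a02 a04 a03 a12 a14 a13 a24 a23 a34)"
    by (intro ext) (simp add: sym4_def)
  show ?thesis
    unfolding eq sum5_add sum5_swap04[of E V sym3, OF assms] sum5_swap14[of E V sym3, OF assms] sum5_swap24[of E V sym3, OF assms] sum5_swap34[of E V sym3, OF assms] by simp
qed

section \<open>Positivity of the square terms\<close>

lemma empty_quadratic_nonneg: "0 \<le> 108 * (p * p) - 38 * (p * q) + 6 * (q * q)" for p q :: int
proof -
  \<comment> \<open>Completing the square: 19/108 is half of 38/108, and 287/108 = 6 - 19^2/108. The
    rational constants in the next two lemmas arise in the same way.\<close>
  have "0 \<le> 108 * (real_of_int p - 19/108 * q)\<^sup>2 + 287/108 * (real_of_int q)\<^sup>2" by simp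
  also have "\<dots> = real_of_int (108 * (p * p) - 38 * (p * q) + 6 * (q * q))"
    by (simp add: power2_eq_square algebra_simps)
  finally show ?thesis by linarith
qed

lemma edge_quadratic_nonneg:
  "0 \<le> 1032 * (a * a) + 540 * (a * c) + 468 * (b * b) - 642 * (b * c) + 303 * (c * c) + 2250 * (d * d)"
  for a b c d :: int
proof -
  have "0 \<le> 1032 * (real_of_int a + 45/172 * c)\<^sup>2 + 468 * (real_of_int b - 107/156 * c)\<^sup>2
      + 27251/2236 * (real_of_int c)\<^sup>2 + 2250 * (real_of_int d)\<^sup>2" by simp
  also have "\<dots> = real_of_int (1032 * (a * a) + 540 * (a * c) + 468 * (b * b) - 642 * (b * c)
      + 303 * (c * c) + 2250 * (d * d))"
    by (simp add: power2_eq_square algebra_simps)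
  finally show ?thesis by linarith
qed

lemma path_quadratic_nonneg: "0 \<le> 219 * (p * p) - 93 * (p * r) + 66 * (r * r) + 1878 * (s * s)" for p r s :: int
proof -
  have "0 \<le> 219 * (real_of_int p - 31/146 * r)\<^sup>2 + 16389/292 * (real_of_int r)\<^sup>2
      + 1878 * (real_of_int s)\<^sup>2" by simp
  also have "\<dots> = real_of_int (219 * (p * p) - 93 * (p * r) + 66 * (r * r) + 1878 * (s * s))"
    by (simp add: power2_eq_square algebra_simps)
  finally show ?thesis by linarith
qed

lemma sum_sum_mult:
  "(\<Sum>w\<in>V. \<Sum>x\<in>V. k * (f w * g x)) = k * (sum f V * sum g V)" for k :: int
  unfolding sum_product by (simp only: sum_distrib_left)

text \<open>For a fixed triple the double sum is a quadratic form evaluated at the sums of the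
  neighbourhood forms over \<open>V\<close>, and each of the three forms is positive semidefinite by
  its completed squares.\<close>

lemma sum_type_square_nonneg:
  "0 \<le> (\<Sum>w\<in>V. \<Sum>x\<in>V. type_square uv ut vt (f w) (g w) (h w) (f x) (g x) (h x))"
  unfolding type_square_def
  by (cases ut; cases uv; cases vt;
    simp only: if_True if_False simp_thms sum.distrib sum_subtractf sum_sum_mult empty_quadratic_nonneg edge_quadratic_nonneg path_quadratic_nonneg sum.neutral_const order.refl)

lemma sum5_type_square_nonneg:
  "0 \<le> sum5 V E (\<lambda>a01 a02 a03 a04 a12 a13 a14 a23 a24 a34. type_square a01 a02 a12 a03 a13 a23 a04 a14 a24)"
proof -
  have "sum5 V E (\<lambda>a01 a02 a03 a04 a12 a13 a14 a23 a24 a34. type_square a01 a02 a12 a03 a13 a23 a04 a14 a24)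
    = (\<Sum>u\<in>V. \<Sum>v\<in>V. \<Sum>t\<in>V. \<Sum>w\<in>V. \<Sum>x\<in>V.
        type_square (E u v) (E u t) (E v t) (E u w) (E v w) (E t w) (E u x) (E v x) (E t x))"
    by (simp add: sum5_def sum.cartesian_product)
  also have "\<dots> \<ge> 0"
    by (intro sum_nonneg sum_type_square_nonneg)
  finally show ?thesis .
qed

text \<open>These are closed 5-walks. In a triangle-free graph distinctness of the vertices and
  absence of chords are automatic, as \<open>bij_betw_embeddings_cycle5\<close> shows.\<close>

definition pentagons :: "'a set \<Rightarrow> ('a \<Rightarrow> 'a \<Rightarrow> bool) \<Rightarrow> ('a \<times> 'a \<times> 'a \<times> 'a \<times> 'a) set" where
  "pentagons V E = {x \<in> V \<times> V \<times> V \<times> V \<times> V. case x of (x0,x1,x2,x3,x4) \<Rightarrow>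
     E x0 x1 \<and> E x1 x2 \<and> E x2 x3 \<and> E x3 x4 \<and> E x0 x4}"

text \<open>
  Nothing is required of \<open>x\<^sub>3x\<^sub>4\<close>: these are the labelled induced copies of a path on four vertices
  plus an isolated vertex and of a path on five vertices.  Neither is an induced subgraph of a
  blow-up of the pentagon.
\<close>

definition bad_paths :: "'a set \<Rightarrow> ('a \<Rightarrow> 'a \<Rightarrow> bool) \<Rightarrow> ('a \<times> 'a \<times> 'a \<times> 'a \<times> 'a) set" where
  "bad_paths V E = {x \<in> V \<times> V \<times> V \<times> V \<times> V. case x of (x0,x1,x2,x3,x4) \<Rightarrow>
     E x0 x1 \<and> E x1 x2 \<and> E x2 x3 \<and> \<not> E x0 x2 \<and> \<not> E x1 x3 \<and> \<not> E x0 x3 \<and>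
     \<not> E x0 x4 \<and> \<not> E x1 x4 \<and> \<not> E x2 x4}"

lemma card_filter_eq_sum:
  "finite T \<Longrightarrow> k * int (card {x \<in> T. P x}) = (\<Sum>x\<in>T. if P x then k else 0)"
  by (simp add: sum.inter_filter[symmetric])

lemma certificate_eq:
  "certificate a01 a02 a03 a04 a12 a13 a14 a23 a24 a34 =
     (if a01 \<and> a12 \<and> a23 \<and> a34 \<and> a04 then 7500 else 0)
   + (if a01 \<and> a12 \<and> a23 \<and> \<not> a02 \<and> \<not> a13 \<and> \<not> a03 \<and> \<not> a04 \<and> \<not> a14 \<and> \<not> a24 then 24 else 0)
   + type_square a01 a02 a12 a03 a13 a23 a04 a14 a24"
  by (simp add: certificate_def)

text \<open>Beyond the bound (2/625) n^5 on pentagons, this says that the number of bad paths is at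
  most the deficit n^5 - (625/2) N, where N counts the pentagons. That is the form in which
  stability uses it.\<close>

lemma pentagon_certificate:
  assumes fin: "finite V" and sym: "\<And>x y. E x y = E y x"
    and tri: "\<And>x y z. E x y \<Longrightarrow> E y z \<Longrightarrow> \<not> E x z"
  shows "7500 * card (pentagons V E) + 24 * card (bad_paths V E) \<le> 24 * card V ^ 5"
proof -
  let ?T = "V \<times> V \<times> V \<times> V \<times> V"
  have fT: "finite ?T" using fin by blast
  have cT: "card ?T = card V ^ 5"
    by (simp add: card_cartesian_product power_numeral_reduce)
  have "7500 * int (card (pentagons V E)) + 24 * int (card (bad_paths V E))
      + sum5 V E (\<lambda>a01 a02 a03 a04 a12 a13 a14 a23 a24 a34. type_square a01 a02 a12 a03 a13 a23 a04 a14 a24)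
    = sum5 V E certificate"
    unfolding pentagons_def bad_paths_def card_filter_eq_sum[OF fT] sum5_def sum.distrib[symmetric]
    by (intro sum.cong refl) (clarsimp simp only: certificate_eq prod.case)
  then have "7500 * int (card (pentagons V E)) + 24 * int (card (bad_paths V E)) \<le> sum5 V E certificate"
    using sum5_type_square_nonneg[of V E] by linarith
  moreover have "120 * sum5 V E certificate \<le> 120 * (24 * int (card V ^ 5))"
  proof -
    \<comment> \<open>The certificate itself need not be at most 24 at each tuple; its average over
      the 120 permutations is, and 2880 = 120 * 24.\<close>
    have "120 * sum5 V E certificate = sum5 V E sym4"
      by (simp only: sum5_sym1[OF sym] sum5_sym2[OF sym] sum5_sym3[OF sym] sum5_sym4[OF sym])
    also have "\<dots> \<le> (\<Sum>x\<in>?T. 2880)"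
      unfolding sum5_def
    proof (rule sum_mono, clarify)
      fix x0 x1 x2 x3 x4
      \<comment> \<open>This covers coinciding vertices too, so tuples with repetitions also have
        triangle-free patterns.\<close>
      have "\<not> (E x y \<and> E x z \<and> E y z)" for x y z
        using tri[of x y z] by blast
      then show "sym4 (E x0 x1) (E x0 x2) (E x0 x3) (E x0 x4) (E x1 x2) (E x1 x3) (E x1 x4)
          (E x2 x3) (E x2 x4) (E x3 x4) \<le> 2880"
        by (intro sym4_le) (simp only: triangle_free10_def simp_thms)
    qed
    also have "\<dots> = 120 * (24 * int (card V ^ 5))" by (simp only: sum_constant cT)
    finally show ?thesis .
  qed
  ultimately have "int (7500 * card (pentagons V E) + 24 * card (bad_paths V E)) \<le> int (24 * card V ^ 5)"
    by simp
  then show ?thesis by (simp only: of_nat_le_iff)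
qed

section \<open>Embeddings and induced densities\<close>

text \<open>Labelled induced copies, taken as extensional functions so that they form a finite set.
  \<open>embeddings H H\<close> is the automorphism group of a finite H.\<close>

definition embeddings :: "'b pair_pre_digraph \<Rightarrow> 'a pair_pre_digraph \<Rightarrow> ('b \<Rightarrow> 'a) set" where
  "embeddings H G = {f \<in> pverts H \<rightarrow>\<^sub>E pverts G. inj_on f (pverts H) \<and>
     (\<forall>u\<in>pverts H. \<forall>v\<in>pverts H. (f u, f v) \<in> parcs G \<longleftrightarrow> (u, v) \<in> parcs H)}"

lemma pair_graph_finite: "pair_graph G \<Longrightarrow> finite (pverts G)"
  by (simp add: pair_graph_def pair_digraph_def pair_fin_digraph.pair_finite_verts)

lemma pair_graph_arcD: "pair_graph G \<Longrightarrow> (u, v) \<in> parcs G \<Longrightarrow> u \<in> pverts G \<and> v \<in> pverts G"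
  by (metis pair_graph_def pair_digraph_def pair_fin_digraph_def pair_wf_digraph.in_arcsD1
      pair_wf_digraph.in_arcsD2)

lemma pair_graph_sym: "pair_graph G \<Longrightarrow> (u, v) \<in> parcs G \<longleftrightarrow> (v, u) \<in> parcs G"
  by (metis pair_graph_def pair_pseudo_graph_def pair_sym_digraph.pair_sym_arcs symmetric_conv
      with_proj_simps(3) symD symmetric_def)

lemma pair_graph_irrefl: "pair_graph G \<Longrightarrow> (u, u) \<notin> parcs G"
  by (metis pair_graph_def pair_digraph_def pair_loopfree_digraph.no_loops')

lemma pair_graphI:
  assumes "finite (pverts G)" "\<And>u v. (u, v) \<in> parcs G \<Longrightarrow> u \<in> pverts G \<and> v \<in> pverts G"
    "\<And>u v. (u, v) \<in> parcs G \<Longrightarrow> (v, u) \<in> parcs G" "\<And>u. (u, u) \<notin> parcs G"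
  shows "pair_graph G"
proof unfold_locales
  have "parcs G \<subseteq> pverts G \<times> pverts G" using assms(2) by auto
  then show "finite (parcs G)" using assms(1) by (meson finite_SigmaI finite_subset)
  show "symmetric (with_proj G)" using assms(3) by (simp add: symmetric_def sym_def)
  show "fst e \<noteq> snd e" if "e \<in> parcs G" for e
    using that assms(4) by (metis prod.collapse)
qed (use assms(1,2) in auto)

text \<open>The library isomorphism maps the induced subgraph to H and carries a separate map on
  arcs. Its inverse on vertices is the embedding; conversely the arc map is induced by the inverse
  of the embedding.\<close>

lemma digraph_iso_induced_iff:
  assumes G: "pair_graph G" and H: "pair_graph H" and S: "S \<subseteq> pverts G"
  shows "digraph_iso (with_proj G \<restriction> S) (with_proj H) \<longleftrightarrow>
    (\<exists>f \<in> embeddings H G. f ` pverts H = S)"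
proof
  assume "digraph_iso (with_proj G \<restriction> S) (with_proj H)"
  then obtain h where h: "pre_digraph.digraph_isomorphism (with_proj G \<restriction> S) h"
    and eq: "with_proj H = app_iso h (with_proj G \<restriction> S)"
    by (auto simp: digraph_iso_def)
  let ?p = "iso_verts h"
  have inj: "inj_on ?p S" using h by (auto simp: pre_digraph.digraph_isomorphism_def)
  have V: "pverts H = ?p ` S" using arg_cong[OF eq, of verts] by simp
  have A: "parcs H = iso_arcs h ` {e \<in> parcs G. fst e \<in> S \<and> snd e \<in> S}"
    using arg_cong[OF eq, of arcs] by simp
  have ht: "iso_tail h = fst" "iso_head h = snd"
    using arg_cong[OF eq, of tail] arg_cong[OF eq, of head] by simp_all
  have arc: "iso_arcs h (u, v) = (?p u, ?p v)" if "(u, v) \<in> parcs G" "u \<in> S" "v \<in> S" for u v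
    using h that ht by (force simp: pre_digraph.digraph_isomorphism_def prod_eq_iff)
  define f where "f = restrict (the_inv_into S ?p) (pverts H)"
  have f: "f (?p u) = u" if "u \<in> S" for u
    using that inj V by (simp add: f_def the_inv_into_f_f)
  have im: "f ` pverts H = S"
    using f unfolding V by (auto simp: image_image)
  have iff: "(?p u, ?p v) \<in> parcs H \<longleftrightarrow> (u, v) \<in> parcs G" if "u \<in> S" "v \<in> S" for u v
  proof
    assume "(?p u, ?p v) \<in> parcs H"
    then obtain e where e: "e \<in> parcs G" "fst e \<in> S" "snd e \<in> S" "(?p u, ?p v) = iso_arcs h e"
      using A by auto
    then have "?p u = ?p (fst e)" "?p v = ?p (snd e)" using arc[of "fst e" "snd e"] by auto
    then show "(u, v) \<in> parcs G" using inj that e by (metis inj_onD prod.collapse)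
  next
    assume "(u, v) \<in> parcs G"
    then show "(?p u, ?p v) \<in> parcs H" using A arc that by force
  qed
  have "f \<in> embeddings H G"
    unfolding embeddings_def
  proof (intro CollectI conjI ballI)
    show "f \<in> pverts H \<rightarrow>\<^sub>E pverts G" using im S by (auto simp: f_def)
    show "inj_on f (pverts H)" unfolding V using f by (auto intro!: inj_onI)
    show "(f u, f v) \<in> parcs G \<longleftrightarrow> (u, v) \<in> parcs H" if uv: "u \<in> pverts H" "v \<in> pverts H" for u v
    proof -
      obtain x y where "x \<in> S" "y \<in> S" "u = ?p x" "v = ?p y" using uv unfolding V by blast
      then show ?thesis by (simp add: f iff)
    qed
  qed
  then show "\<exists>f \<in> embeddings H G. f ` pverts H = S" using im by blast
next
  assume "\<exists>f \<in> embeddings H G. f ` pverts H = S"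
  then obtain f where f: "f \<in> embeddings H G" "f ` pverts H = S" by blast
  then have inj: "inj_on f (pverts H)"
    and iff: "\<And>u v. u \<in> pverts H \<Longrightarrow> v \<in> pverts H \<Longrightarrow> (f u, f v) \<in> parcs G \<longleftrightarrow> (u, v) \<in> parcs H"
    by (auto simp: embeddings_def)
  define p where "p = the_inv_into (pverts H) f"
  have p: "p (f u) = u" if "u \<in> pverts H" for u
    using that inj by (simp add: p_def the_inv_into_f_f)
  define h where "h = \<lparr>iso_verts = p, iso_arcs = (\<lambda>(u, v). (p u, p v)), iso_head = snd, iso_tail = fst\<rparr>"
  have injp: "inj_on p S" using p f(2) by (auto intro!: inj_onI)
  have "wf_digraph (with_proj G \<restriction> S)"
    by unfold_locales auto
  then have "pre_digraph.digraph_isomorphism (with_proj G \<restriction> S) h"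
    using injp by (auto simp: pre_digraph.digraph_isomorphism_def h_def inj_on_def)
  moreover have "with_proj H = app_iso h (with_proj G \<restriction> S)"
  proof (rule pre_digraph.equality)
    show "verts (with_proj H) = verts (app_iso h (with_proj G \<restriction> S))"
      using p f(2) by (force simp: h_def)
    show "arcs (with_proj H) = arcs (app_iso h (with_proj G \<restriction> S))"
    proof (intro set_eqI iffI)
      fix e assume "e \<in> arcs (with_proj H)"
      then obtain u v where e: "e = (u, v)" "(u, v) \<in> parcs H" by (cases e) auto
      then have uv: "u \<in> pverts H" "v \<in> pverts H" using pair_graph_arcD[OF H] by auto
      then have "(f u, f v) \<in> parcs G" "f u \<in> S" "f v \<in> S" using iff e f(2) by auto
      moreover have "e = iso_arcs h (f u, f v)" using p uv e by (simp add: h_def)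
      ultimately show "e \<in> arcs (app_iso h (with_proj G \<restriction> S))" by force
    next
      fix e assume "e \<in> arcs (app_iso h (with_proj G \<restriction> S))"
      then obtain x y where xy: "e = (p x, p y)" "(x, y) \<in> parcs G" "x \<in> S" "y \<in> S"
        by (auto simp: h_def)
      then obtain u v where "u \<in> pverts H" "v \<in> pverts H" "x = f u" "y = f v" using f(2) by auto
      then show "e \<in> arcs (with_proj H)" using xy p iff by simp
    qed
  qed (simp_all add: h_def)
  ultimately show "digraph_iso (with_proj G \<restriction> S) (with_proj H)"
    unfolding digraph_iso_def by blast
qed

lemma finite_embeddings: "finite (pverts H) \<Longrightarrow> finite (pverts G) \<Longrightarrow> finite (embeddings H G)"
  by (rule finite_subset[of _ "pverts H \<rightarrow>\<^sub>E pverts G"]) (auto simp: embeddings_def finite_PiE)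

text \<open>Automorphisms act freely and transitively on the embeddings with a given image: these
  are exactly the maps \<open>f0 \<circ> g\<close>, where g is an automorphism because an injection
  of a finite set into itself is onto.\<close>

lemma card_embeddings_image:
  assumes f0: "f0 \<in> embeddings H G" and fin: "finite (pverts H)"
  shows "card {f \<in> embeddings H G. f ` pverts H = f0 ` pverts H} = card (embeddings H H)"
proof (rule bij_betw_same_card[symmetric, of "\<lambda>g. restrict (f0 \<circ> g) (pverts H)"],
    rule bij_betw_byWitness[where f' = "\<lambda>f. restrict (the_inv_into (pverts H) f0 \<circ> f) (pverts H)"])
  let ?V = "pverts H" and ?i = "the_inv_into (pverts H) f0"
  have inj: "inj_on f0 ?V" and f0V: "f0 \<in> ?V \<rightarrow>\<^sub>E pverts G"
    and iff: "\<And>u v. u \<in> ?V \<Longrightarrow> v \<in> ?V \<Longrightarrow> (f0 u, f0 v) \<in> parcs G \<longleftrightarrow> (u, v) \<in> parcs H"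
    using f0 by (auto simp: embeddings_def)
  have i: "?i (f0 u) = u" if "u \<in> ?V" for u using that inj by (simp add: the_inv_into_f_f)
  have i': "?i x \<in> ?V \<and> f0 (?i x) = x" if "x \<in> f0 ` ?V" for x
    using that i by auto
  show "\<forall>g\<in>embeddings H H. restrict (?i \<circ> restrict (f0 \<circ> g) ?V) ?V = g"
  proof (intro ballI ext)
    fix g u assume "g \<in> embeddings H H"
    then show "restrict (?i \<circ> restrict (f0 \<circ> g) ?V) ?V u = g u"
      using i by (cases "u \<in> ?V") (auto simp: embeddings_def PiE_def extensional_def)
  qed
  show "\<forall>f\<in>{f \<in> embeddings H G. f ` ?V = f0 ` ?V}. restrict (f0 \<circ> restrict (?i \<circ> f) ?V) ?V = f"
  proof (intro ballI ext)
    fix f u assume f: "f \<in> {f \<in> embeddings H G. f ` ?V = f0 ` ?V}"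
    then have "f0 (?i (f u)) = f u" if "u \<in> ?V" using that i' by blast
    then show "restrict (f0 \<circ> restrict (?i \<circ> f) ?V) ?V u = f u"
      using f by (cases "u \<in> ?V") (auto simp: embeddings_def PiE_def extensional_def)
  qed
  show "(\<lambda>g. restrict (f0 \<circ> g) ?V) ` embeddings H H \<subseteq> {f \<in> embeddings H G. f ` ?V = f0 ` ?V}"
  proof clarify
    fix g assume g: "g \<in> embeddings H H"
    then have gV: "\<And>u. u \<in> ?V \<Longrightarrow> g u \<in> ?V" and gi: "inj_on g ?V" by (auto simp: embeddings_def)
    have gim: "g ` ?V = ?V" using gV gi fin by (intro endo_inj_surj) auto
    have "inj_on (f0 \<circ> g) ?V" using gi inj gim by (intro comp_inj_on) auto
    moreover have "(f0 \<circ> g) ` ?V = f0 ` ?V" using gim by (metis image_comp)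
    ultimately show "restrict (f0 \<circ> g) ?V \<in> embeddings H G \<and> restrict (f0 \<circ> g) ?V ` ?V = f0 ` ?V"
      using g f0V gV iff by (auto simp: embeddings_def)
  qed
  show "(\<lambda>f. restrict (?i \<circ> f) ?V) ` {f \<in> embeddings H G. f ` ?V = f0 ` ?V} \<subseteq> embeddings H H"
  proof clarify
    fix f assume f: "f \<in> embeddings H G" and fim: "f ` ?V = f0 ` ?V"
    have fx: "?i (f u) \<in> ?V \<and> f0 (?i (f u)) = f u" if "u \<in> ?V" for u
      using that fim i' by blast
    have "inj_on (?i \<circ> f) ?V"
    proof (rule inj_onI)
      fix u v assume uv: "u \<in> ?V" "v \<in> ?V" "(?i \<circ> f) u = (?i \<circ> f) v"
      then have "f u = f v" using fx by (metis comp_apply)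
      then show "u = v" using f uv by (auto simp: embeddings_def dest: inj_onD)
    qed
    moreover have "(?i (f u), ?i (f v)) \<in> parcs H \<longleftrightarrow> (u, v) \<in> parcs H" if "u \<in> ?V" "v \<in> ?V" for u v
      using iff[of "?i (f u)" "?i (f v)"] fx that f by (auto simp: embeddings_def)
    ultimately show "restrict (?i \<circ> f) ?V \<in> embeddings H H"
      using fx by (auto simp: embeddings_def)
  qed
qed

text \<open>Sort the embeddings by image: each subset that induces a copy of H is hit once per
  automorphism.\<close>

lemma card_embeddings:
  assumes G: "pair_graph G" and H: "pair_graph H"
  shows "card (embeddings H G) =
    card {S. S \<subseteq> pverts G \<and> card S = card (pverts H) \<and>
      digraph_iso (with_proj G \<restriction> S) (with_proj H)} * card (embeddings H H)"
proof -
  let ?I = "(\<lambda>f. f ` pverts H) ` embeddings H G"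
  have I: "S \<subseteq> pverts G \<and> card S = card (pverts H)" if "S \<in> ?I" for S
    using that by (auto simp: embeddings_def card_image)
  have "{S. S \<subseteq> pverts G \<and> card S = card (pverts H) \<and>
      digraph_iso (with_proj G \<restriction> S) (with_proj H)} = ?I"
  proof (intro set_eqI iffI)
    fix S assume "S \<in> ?I"
    then show "S \<in> {S. S \<subseteq> pverts G \<and> card S = card (pverts H) \<and>
        digraph_iso (with_proj G \<restriction> S) (with_proj H)}"
      using I[of S] digraph_iso_induced_iff[OF G H, of S] by auto
  next
    fix S assume "S \<in> {S. S \<subseteq> pverts G \<and> card S = card (pverts H) \<and>
        digraph_iso (with_proj G \<restriction> S) (with_proj H)}"
    then show "S \<in> ?I"
      using digraph_iso_induced_iff[OF G H, of S] by auto
  qed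
  moreover have "card (embeddings H G) = (\<Sum>S\<in>?I. card {f \<in> embeddings H G. f ` pverts H = S})"
    using finite_embeddings[of H G] G H pair_graph_finite
    by (subst card_eq_sum, subst sum.image_gen[where g = "\<lambda>f. f ` pverts H"]) auto
  moreover have "\<dots> = (\<Sum>S\<in>?I. card (embeddings H H))"
    using H by (intro sum.cong) (auto simp: card_embeddings_image pair_graph_finite)
  ultimately show ?thesis by simp
qed

lemma card_embeddings_self_pos:
  assumes "pair_graph H"
  shows "0 < card (embeddings H H)"
proof -
  have "restrict id (pverts H) \<in> embeddings H H"
    by (auto simp: embeddings_def)
  then show ?thesis
    using assms by (metis card_gt_0_iff empty_iff finite_embeddings pair_graph_finite)
qed

lemma induced_density_eq:
  assumes "pair_graph G" "pair_graph H"
  shows "induced_density H G = card (embeddings H G) /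
    (card (embeddings H H) * (card (pverts G) choose card (pverts H)))"
  using card_embeddings[OF assms] card_embeddings_self_pos[OF assms(2)]
    n_subsets[OF pair_graph_finite[OF assms(1)], of "card (pverts H)"]
  by (simp add: induced_density_def)

section \<open>Graphs close to a blow-up of the pentagon\<close>

text \<open>A condition on two coordinates leaves all the others free. It serves both for counting
  defective pairs and for pentagons through a prescribed pair of classes.\<close>

lemma card_PiE_pair:
  assumes I: "finite I" "a \<in> I" "b \<in> I" "a \<noteq> b"
  shows "card {f \<in> PiE I A. P (f a) (f b)} =
    card {(x, y) \<in> A a \<times> A b. P x y} * (\<Prod>j\<in>I - {a, b}. card (A j))"
proof -
  have "card {f \<in> PiE I A. P (f a) (f b)} =
      card ({(x, y) \<in> A a \<times> A b. P x y} \<times> PiE (I - {a, b}) A)"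
  proof -
    define to where "to f = ((f a, f b), restrict f (I - {a, b}))" for f :: "'a \<Rightarrow> 'b"
    define fro where "fro p = (snd p)(a := fst (fst p), b := snd (fst p))" for p :: "('b \<times> 'b) \<times> ('a \<Rightarrow> 'b)"
    have "bij_betw to {f \<in> PiE I A. P (f a) (f b)}
        ({(x, y) \<in> A a \<times> A b. P x y} \<times> PiE (I - {a, b}) A)"
    proof (rule bij_betw_byWitness[where f' = fro])
      show "\<forall>f\<in>{f \<in> PiE I A. P (f a) (f b)}. fro (to f) = f"
      proof (intro ballI ext)
        fix f j assume "f \<in> {f \<in> PiE I A. P (f a) (f b)}"
        then show "fro (to f) j = f j"
          using I by (cases "j \<in> I") (auto simp: to_def fro_def PiE_def extensional_def)
      qed
      show "\<forall>p\<in>{(x, y) \<in> A a \<times> A b. P x y} \<times> PiE (I - {a, b}) A. to (fro p) = p"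
      proof
        fix p assume "p \<in> {(x, y) \<in> A a \<times> A b. P x y} \<times> PiE (I - {a, b}) A"
        then obtain x y g where p: "p = ((x, y), g)" and g: "g \<in> PiE (I - {a, b}) A"
          by (cases p) auto
        have "restrict (g(a := x, b := y)) (I - {a, b}) = restrict g (I - {a, b})"
          by (rule restrict_ext) simp
        also have "\<dots> = g" using g by (metis PiE_restrict)
        finally show "to (fro p) = p" using I by (simp add: to_def fro_def p)
      qed
      show "to ` {f \<in> PiE I A. P (f a) (f b)}
          \<subseteq> {(x, y) \<in> A a \<times> A b. P x y} \<times> PiE (I - {a, b}) A"
        using I by (auto simp: to_def PiE_def Pi_def)
      show "fro ` ({(x, y) \<in> A a \<times> A b. P x y} \<times> PiE (I - {a, b}) A)
          \<subseteq> {f \<in> PiE I A. P (f a) (f b)}"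
        using I by (auto simp: fro_def PiE_def Pi_def extensional_def)
    qed
    then show ?thesis by (rule bij_betw_same_card)
  qed
  also have "\<dots> = card {(x, y) \<in> A a \<times> A b. P x y} * (\<Prod>j\<in>I - {a, b}. card (A j))"
    using I(1) by (simp add: card_cartesian_product card_PiE)
  finally show ?thesis .
qed

definition colourings :: "'b pair_pre_digraph \<Rightarrow> ('b \<Rightarrow> nat) set" where
  "colourings H = {c \<in> pverts H \<rightarrow>\<^sub>E {..<5}.
     \<forall>u\<in>pverts H. \<forall>v\<in>pverts H. (c u, c v) \<in> parcs cycle5 \<longleftrightarrow> (u, v) \<in> parcs H}"

lemma finite_colourings: "finite (pverts H) \<Longrightarrow> finite (colourings H)"
  by (rule finite_subset[of _ "pverts H \<rightarrow>\<^sub>E {..<5}"]) (auto simp: colourings_def finite_PiE)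

definition colour_class :: "'a pair_pre_digraph \<Rightarrow> ('a \<Rightarrow> nat) \<Rightarrow> nat \<Rightarrow> 'a set" where
  "colour_class G c i = {v \<in> pverts G. c v = i}"

definition wrong_pairs :: "'a pair_pre_digraph \<Rightarrow> ('a \<Rightarrow> nat) \<Rightarrow> ('a \<times> 'a) set" where
  "wrong_pairs G c = {(u, v) \<in> pverts G \<times> pverts G.
     ((u, v) \<in> parcs G) \<noteq> ((c u, c v) \<in> parcs cycle5)}"

lemma cycle5_irrefl: "(i, i) \<notin> parcs cycle5"
  by (auto simp: cycle5_def mod_Suc)

text \<open>Grouping the maps by their colour pattern gives a disjoint union of products of classes.
  The maps may repeat vertices; collisions are charged to the error term later.\<close>

lemma card_coloured_maps:
  assumes H: "finite (pverts H)" and c: "\<And>v. v \<in> pverts G \<Longrightarrow> c v < 5"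
    and G: "finite (pverts G)"
  shows "card {f \<in> pverts H \<rightarrow>\<^sub>E pverts G. restrict (c \<circ> f) (pverts H) \<in> colourings H} =
    (\<Sum>col\<in>colourings H. \<Prod>u\<in>pverts H. card (colour_class G c (col u)))"
proof -
  have "{f \<in> pverts H \<rightarrow>\<^sub>E pverts G. restrict (c \<circ> f) (pverts H) \<in> colourings H} =
      (\<Union>col\<in>colourings H. PiE (pverts H) (\<lambda>u. colour_class G c (col u)))"
  proof (intro set_eqI iffI)
    fix f assume f: "f \<in> {f \<in> pverts H \<rightarrow>\<^sub>E pverts G. restrict (c \<circ> f) (pverts H) \<in> colourings H}"
    then have "f \<in> PiE (pverts H) (\<lambda>u. colour_class G c (restrict (c \<circ> f) (pverts H) u))"
      by (auto simp: colour_class_def)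
    then show "f \<in> (\<Union>col\<in>colourings H. PiE (pverts H) (\<lambda>u. colour_class G c (col u)))"
      using f by blast
  next
    fix f assume "f \<in> (\<Union>col\<in>colourings H. PiE (pverts H) (\<lambda>u. colour_class G c (col u)))"
    then obtain col where col: "col \<in> colourings H" "f \<in> PiE (pverts H) (\<lambda>u. colour_class G c (col u))"
      by blast
    then have "restrict (c \<circ> f) (pverts H) = col"
      by (auto simp: colourings_def colour_class_def fun_eq_iff restrict_def PiE_def Pi_def extensional_def)
    then show "f \<in> {f \<in> pverts H \<rightarrow>\<^sub>E pverts G. restrict (c \<circ> f) (pverts H) \<in> colourings H}"
      using col by (auto simp: colour_class_def PiE_def Pi_def)
  qed
  also have "card \<dots> = (\<Sum>col\<in>colourings H. card (PiE (pverts H) (\<lambda>u. colour_class G c (col u))))"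
  proof (rule card_UN_disjoint)
    show "finite (colourings H)" using H by (rule finite_colourings)
    show "\<forall>col\<in>colourings H. finite (PiE (pverts H) (\<lambda>u. colour_class G c (col u)))"
      using H G by (auto intro!: finite_PiE simp: colour_class_def)
    show "\<forall>col\<in>colourings H. \<forall>col'\<in>colourings H. col \<noteq> col' \<longrightarrow>
        PiE (pverts H) (\<lambda>u. colour_class G c (col u)) \<inter> PiE (pverts H) (\<lambda>u. colour_class G c (col' u)) = {}"
    proof (intro ballI impI, rule ccontr)
      fix col col' assume cc: "col \<in> colourings H" "col' \<in> colourings H" "col \<noteq> col'"
        and "PiE (pverts H) (\<lambda>u. colour_class G c (col u)) \<inter> PiE (pverts H) (\<lambda>u. colour_class G c (col' u)) \<noteq> {}"
      then obtain f where "f \<in> PiE (pverts H) (\<lambda>u. colour_class G c (col u))"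
        "f \<in> PiE (pverts H) (\<lambda>u. colour_class G c (col' u))" by blast
      then have "col u = col' u" if "u \<in> pverts H" for u
        using that by (auto simp: colour_class_def PiE_def Pi_def)
      then have "col = col'" using cc(1,2) by (auto simp: colourings_def intro: PiE_ext)
      then show False using cc(3) by simp
    qed
  qed
  finally show ?thesis using H by (simp add: card_PiE)
qed

lemma finite_wrong_pairs: "finite (pverts G) \<Longrightarrow> finite (wrong_pairs G c)"
  by (rule finite_subset[of _ "pverts G \<times> pverts G"]) (auto simp: wrong_pairs_def)

text \<open>A union bound over the at most h^2 ordered pairs in I: each has at most p choices of
  values, times n^(h-2) for the remaining coordinates.\<close>

lemma card_maps_bad_pair:
  fixes n p :: real
  assumes A: "finite A" and I: "finite I" and h: "h = card I"
    and n: "n = real (card A)" "n > 0" and P: "card {(x, y) \<in> A \<times> A. P x y} \<le> p"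
  shows "card {f \<in> I \<rightarrow>\<^sub>E A. \<exists>u\<in>I. \<exists>v\<in>I. u \<noteq> v \<and> P (f u) (f v)} \<le> n ^ h * (real h ^ 2 * (p / n ^ 2))"
proof -
  have p0: "0 \<le> p" by (rule order_trans[OF of_nat_0_le_iff P])
  have pair: "real (card {f \<in> I \<rightarrow>\<^sub>E A. P (f u) (f v)}) \<le> n ^ h * (p / n ^ 2)"
    if uv: "u \<in> I" "v \<in> I" "u \<noteq> v" for u v
  proof -
    have "card {u, v} \<le> h" using uv I unfolding h by (intro card_mono) auto
    then have h2: "h \<ge> 2" using uv by simp
    have "card (I - {u, v}) = h - 2" using uv I h by (simp add: card_Diff_subset)
    then have "real (card {f \<in> I \<rightarrow>\<^sub>E A. P (f u) (f v)}) =
        card {(x, y) \<in> A \<times> A. P x y} * n ^ (h - 2)"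
      using card_PiE_pair[OF I uv, of "\<lambda>_. A" P] n(1) by simp
    also have "\<dots> \<le> p * n ^ (h - 2)"
      using P n(2) by (intro mult_right_mono) auto
    also have "\<dots> = n ^ h * (p / n ^ 2)"
    proof -
      have "n ^ h = n ^ 2 * n ^ (h - 2)"
        using h2 by (metis le_add_diff_inverse power_add)
      then show ?thesis using n(2) by simp
    qed
    finally show ?thesis .
  qed
  have "{f \<in> I \<rightarrow>\<^sub>E A. \<exists>u\<in>I. \<exists>v\<in>I. u \<noteq> v \<and> P (f u) (f v)}
      = (\<Union>u\<in>I. \<Union>v\<in>{v \<in> I. u \<noteq> v}. {f \<in> I \<rightarrow>\<^sub>E A. P (f u) (f v)})"
    by auto
  also have "card \<dots> \<le> (\<Sum>u\<in>I. card (\<Union>v\<in>{v \<in> I. u \<noteq> v}. {f \<in> I \<rightarrow>\<^sub>E A. P (f u) (f v)}))"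
    by (rule card_UN_le[OF I])
  also have "\<dots> \<le> (\<Sum>u\<in>I. \<Sum>v\<in>{v \<in> I. u \<noteq> v}. card {f \<in> I \<rightarrow>\<^sub>E A. P (f u) (f v)})"
    using I by (intro sum_mono card_UN_le) auto
  finally have "real (card {f \<in> I \<rightarrow>\<^sub>E A. \<exists>u\<in>I. \<exists>v\<in>I. u \<noteq> v \<and> P (f u) (f v)}) \<le>
      (\<Sum>u\<in>I. \<Sum>v\<in>{v \<in> I. u \<noteq> v}. real (card {f \<in> I \<rightarrow>\<^sub>E A. P (f u) (f v)}))"
    unfolding of_nat_sum[symmetric] of_nat_le_iff .
  also have "\<dots> \<le> (\<Sum>u\<in>I. \<Sum>v\<in>{v \<in> I. u \<noteq> v}. n ^ h * (p / n ^ 2))"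
    using pair by (intro sum_mono) auto
  also have "\<dots> \<le> (\<Sum>u\<in>I. \<Sum>v\<in>I. n ^ h * (p / n ^ 2))"
    using I n(2) p0 by (intro sum_mono sum_mono2) auto
  also have "\<dots> = n ^ h * (real h ^ 2 * (p / n ^ 2))"
    by (simp add: h power2_eq_square)
  finally show ?thesis .
qed

text \<open>A map without collisions and without wrong pairs is an embedding exactly when its colour
  pattern is a colouring. The two counts therefore differ by at most the number of maps with a
  defective pair.\<close>

lemma card_embeddings_approx:
  fixes n :: real
  assumes G: "pair_graph G" and H: "pair_graph H" and c: "\<And>v. v \<in> pverts G \<Longrightarrow> c v < 5"
    and n: "n = real (card (pverts G))" "n > 0" and h: "h = card (pverts H)"
  shows "\<bar>card (embeddings H G) / n ^ h
      - (\<Sum>col\<in>colourings H. \<Prod>u\<in>pverts H. card (colour_class G c (col u)) / n)\<bar>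
    \<le> real h ^ 2 * ((n + card (wrong_pairs G c)) / n ^ 2)"
proof -
  let ?V = "pverts H" and ?T = "pverts H \<rightarrow>\<^sub>E pverts G"
  let ?s = "\<Sum>col\<in>colourings H. \<Prod>u\<in>pverts H. card (colour_class G c (col u)) / n"
  \<comment> \<open>The two kinds of defect, a collision and a wrong pair; collisions make up the
    summand n of the error.\<close>
  define P where "P x y \<longleftrightarrow> x = y \<or> (x, y) \<in> wrong_pairs G c" for x y
  define D where "D = {f \<in> ?T. \<exists>u\<in>?V. \<exists>v\<in>?V. u \<noteq> v \<and> P (f u) (f v)}"
  define K where "K = {f \<in> ?T. restrict (c \<circ> f) ?V \<in> colourings H}"
  have finG: "finite (pverts G)" and finH: "finite ?V" using G H by (auto intro: pair_graph_finite)
  have finT: "finite ?T" using finG finH by (simp add: finite_PiE)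
  have iff: "f \<in> embeddings H G \<longleftrightarrow> f \<in> K" if f: "f \<in> ?T" "f \<notin> D" for f
  proof -
    have nP: "f u \<noteq> f v \<and> (f u, f v) \<notin> wrong_pairs G c" if "u \<in> ?V" "v \<in> ?V" "u \<noteq> v" for u v
      using f that unfolding D_def P_def by blast
    have "((f u, f v) \<in> parcs G) = ((c (f u), c (f v)) \<in> parcs cycle5)" if "u \<in> ?V" "v \<in> ?V" for u v
    proof (cases "u = v")
      case True then show ?thesis using pair_graph_irrefl[OF G] cycle5_irrefl by simp
    next
      case False
      then show ?thesis using nP[OF that False] f that by (auto simp: wrong_pairs_def PiE_def Pi_def)
    qed
    moreover have "inj_on f ?V" using nP by (auto intro: inj_onI)
    ultimately show ?thesis
      using f c by (auto simp: embeddings_def K_def colourings_def PiE_def Pi_def)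
  qed
  have sub: "embeddings H G \<subseteq> ?T" "K \<subseteq> ?T" "D \<subseteq> ?T" by (auto simp: embeddings_def K_def D_def)
  then have fins: "finite (embeddings H G)" "finite K" "finite D" using finT finite_subset by blast+
  have "embeddings H G \<subseteq> K \<union> D" "K \<subseteq> embeddings H G \<union> D"
    using iff sub by blast+
  then have "card (embeddings H G) \<le> card (K \<union> D)" "card K \<le> card (embeddings H G \<union> D)"
    using fins by (simp_all add: card_mono)
  then have "card (embeddings H G) \<le> card K + card D" "card K \<le> card (embeddings H G) + card D"
    using card_Un_le order_trans by blast+
  then have diff: "\<bar>real (card (embeddings H G)) - card K\<bar> \<le> card D" by linarith
  have "real (card K) = (\<Sum>col\<in>colourings H. \<Prod>u\<in>?V. real (card (colour_class G c (col u))))"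
    unfolding K_def using card_coloured_maps[OF finH c finG] by simp
  also have "\<dots> = (\<Sum>col\<in>colourings H. n ^ h * (\<Prod>u\<in>?V. card (colour_class G c (col u)) / n))"
    using n by (simp add: prod_dividef h)
  finally have K: "real (card K) = n ^ h * ?s"
    by (simp only: sum_distrib_left)
  have "{(x, y) \<in> pverts G \<times> pverts G. P x y} \<subseteq> (\<lambda>x. (x, x)) ` pverts G \<union> wrong_pairs G c"
    unfolding P_def by blast
  then have "card {(x, y) \<in> pverts G \<times> pverts G. P x y} \<le>
      card ((\<lambda>x. (x, x)) ` pverts G \<union> wrong_pairs G c)"
    using finG finite_wrong_pairs by (intro card_mono) auto
  also have "\<dots> \<le> card ((\<lambda>x. (x, x)) ` pverts G) + card (wrong_pairs G c)"
    by (rule card_Un_le)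
  also have "\<dots> \<le> card (pverts G) + card (wrong_pairs G c)"
    using card_image_le[OF finG] by (intro add_right_mono)
  finally have "real (card {(x, y) \<in> pverts G \<times> pverts G. P x y}) \<le> n + card (wrong_pairs G c)"
    using n(1) by linarith
  then have D: "card D \<le> n ^ h * (real h ^ 2 * ((n + card (wrong_pairs G c)) / n ^ 2))"
    unfolding D_def by (rule card_maps_bad_pair[OF finG finH h n])
  have n0: "n ^ h > 0" using n by simp
  have Ks: "card K / n ^ h = ?s"
    unfolding K by (rule nonzero_mult_div_cancel_left) (use n(2) in simp)
  have "\<bar>card (embeddings H G) / n ^ h - ?s\<bar> = \<bar>(real (card (embeddings H G)) - card K) / n ^ h\<bar>"
    by (simp only: diff_divide_distrib Ks)
  also have "\<dots> = \<bar>real (card (embeddings H G)) - card K\<bar> / n ^ h"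
    using n0 by (simp add: abs_divide)
  also have "\<dots> \<le> (n ^ h * (real h ^ 2 * ((n + card (wrong_pairs G c)) / n ^ 2))) / n ^ h"
    using diff D n0 by (intro divide_right_mono) auto
  finally show ?thesis using n(2) by simp
qed

section \<open>From embedding counts to limits of induced densities\<close>

lemma eventually_gt_of_filterlim_at_top:
  fixes m :: "nat \<Rightarrow> nat"
  assumes "filterlim m at_top sequentially"
  shows "\<forall>\<^sub>F n in sequentially. k < m n"
  by (rule assms[unfolded filterlim_iff, rule_format, OF eventually_gt_at_top])

lemma binomial_over_power_tendsto:
  fixes m :: "nat \<Rightarrow> nat"
  assumes m: "filterlim m at_top sequentially"
  shows "(\<lambda>n. real (m n choose h) / real (m n) ^ h) \<longlonglongrightarrow> 1 / fact h"
proof -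
  have lim: "(\<lambda>n. (\<Prod>i=0..<h. 1 - real i / real (m n)) / fact h) \<longlonglongrightarrow> (\<Prod>i=0..<h. 1 - 0) / fact h"
    by (intro tendsto_intros tendsto_divide_0[OF tendsto_const] filterlim_at_top_imp_at_infinity
        filterlim_compose[OF filterlim_real_sequentially m]) simp_all
  have "\<forall>\<^sub>F n in sequentially. m n > 0"
    using m by (rule eventually_gt_of_filterlim_at_top)
  then have "\<forall>\<^sub>F n in sequentially. (\<Prod>i=0..<h. 1 - real i / real (m n)) / fact h
      = real (m n choose h) / real (m n) ^ h"
  proof eventually_elim
    case (elim n)
    have "(\<Prod>i=0..<h. real (m n) - real i) = (\<Prod>i=0..<h. real (m n) * (1 - real i / real (m n)))"
      using elim by (intro prod.cong) (simp_all add: right_diff_distrib)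
    also have "\<dots> = real (m n) ^ h * (\<Prod>i=0..<h. 1 - real i / real (m n))"
      by (simp add: prod.distrib)
    finally show ?case
      using elim by (simp add: binomial_gbinomial gbinomial_prod_rev)
  qed
  then show ?thesis
    using lim by (simp add: tendsto_cong)
qed

text \<open>The normalisations n^h and (n choose h) differ asymptotically by h!. Both directions
  matter: the assumption on pentagons becomes an embedding count, and embedding counts become
  induced densities.\<close>

lemma embeddings_density_tendsto_iff:
  assumes G: "\<And>n. pair_graph (G n)" and H: "pair_graph H"
    and inf: "filterlim (\<lambda>n. card (pverts (G n))) at_top sequentially"
  shows "(\<lambda>n. card (embeddings H (G n)) / real (card (pverts (G n))) ^ card (pverts H)) \<longlonglongrightarrow> d \<longleftrightarrow>
    (\<lambda>n. induced_density H (G n)) \<longlonglongrightarrow> d * fact (card (pverts H)) / card (embeddings H H)"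
    (is "?e \<longlonglongrightarrow> d \<longleftrightarrow> ?i \<longlonglongrightarrow> _")
proof -
  let ?h = "card (pverts H)" and ?m = "\<lambda>n. card (pverts (G n))" and ?a = "real (card (embeddings H H))"
  let ?b = "\<lambda>n. real (?m n choose ?h) / real (?m n) ^ ?h"
  have a: "?a > 0" using card_embeddings_self_pos[OF H] by simp
  have b: "?b \<longlonglongrightarrow> 1 / fact ?h" by (rule binomial_over_power_tendsto[OF inf])
  have "\<forall>\<^sub>F n in sequentially. ?m n > ?h"
    using inf by (rule eventually_gt_of_filterlim_at_top)
  then have ev: "\<forall>\<^sub>F n in sequentially. ?e n = ?a * ?i n * ?b n \<and> ?i n = ?e n / (?a * ?b n)"
  proof eventually_elim
    case (elim n)
    then have "real (?m n choose ?h) > 0" "real (?m n) ^ ?h > 0" by auto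
    then show ?case using a induced_density_eq[OF G H, of n] by simp
  qed
  show ?thesis
  proof
    assume e: "?e \<longlonglongrightarrow> d"
    have "?a * (1 / fact ?h) \<noteq> 0" using a by simp
    from tendsto_divide[OF e tendsto_mult[OF tendsto_const b] this]
    have "(\<lambda>n. ?e n / (?a * ?b n)) \<longlonglongrightarrow> d / (?a * (1 / fact ?h))" .
    moreover have "\<forall>\<^sub>F n in sequentially. ?e n / (?a * ?b n) = ?i n"
      using ev by eventually_elim (rule conjunct2[THEN sym])
    ultimately show "?i \<longlonglongrightarrow> d * fact ?h / ?a"
      by (simp add: tendsto_cong)
  next
    assume i: "?i \<longlonglongrightarrow> d * fact ?h / ?a"
    have "(\<lambda>n. ?a * ?i n * ?b n) \<longlonglongrightarrow> ?a * (d * fact ?h / ?a) * (1 / fact ?h)"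
      by (rule tendsto_mult[OF tendsto_mult[OF tendsto_const i] b])
    moreover have "\<forall>\<^sub>F n in sequentially. ?a * ?i n * ?b n = ?e n"
      using ev by eventually_elim (rule conjunct1[THEN sym])
    ultimately have "?e \<longlonglongrightarrow> ?a * (d * fact ?h / ?a) * (1 / fact ?h)"
      by (simp only: tendsto_cong)
    then show "?e \<longlonglongrightarrow> d" using a by simp
  qed
qed

text \<open>Each colouring contributes 5^(-h) in the limit, and the collision and wrong-pair errors
  vanish. The limit depends on H alone, so extremal sequences and blow-ups of the pentagon share
  it.\<close>

lemma coloured_induced_density_tendsto:
  fixes G :: "nat \<Rightarrow> 'a pair_pre_digraph" and c :: "nat \<Rightarrow> 'a \<Rightarrow> nat"
  assumes G: "\<And>n. pair_graph (G n)" and H: "pair_graph H"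
    and c: "\<And>n v. v \<in> pverts (G n) \<Longrightarrow> c n v < 5"
    and inf: "filterlim (\<lambda>n. card (pverts (G n))) at_top sequentially"
    and classes: "\<And>i. i < 5 \<Longrightarrow>
      (\<lambda>n. card (colour_class (G n) (c n) i) / real (card (pverts (G n)))) \<longlonglongrightarrow> 1 / 5"
    and wrong: "(\<lambda>n. card (wrong_pairs (G n) (c n)) / real (card (pverts (G n))) ^ 2) \<longlonglongrightarrow> 0"
  shows "(\<lambda>n. induced_density H (G n)) \<longlonglongrightarrow>
    card (colourings H) / 5 ^ card (pverts H) * fact (card (pverts H)) / card (embeddings H H)"
proof (subst embeddings_density_tendsto_iff[OF G H inf, symmetric])
  let ?h = "card (pverts H)" and ?m = "\<lambda>n. real (card (pverts (G n)))"
  let ?s = "\<lambda>n. \<Sum>col\<in>colourings H. \<Prod>u\<in>pverts H. card (colour_class (G n) (c n) (col u)) / ?m n"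
  let ?e = "\<lambda>n. card (embeddings H (G n)) / ?m n ^ ?h"
  have "?s \<longlonglongrightarrow> (\<Sum>col\<in>colourings H. \<Prod>u\<in>pverts H. 1 / 5)"
    by (intro tendsto_sum tendsto_prod classes) (auto simp: colourings_def)
  then have s: "?s \<longlonglongrightarrow> card (colourings H) / 5 ^ ?h"
    by (simp add: power_one_over)
  have minf: "filterlim ?m at_infinity sequentially"
    by (intro filterlim_at_top_imp_at_infinity filterlim_compose[OF filterlim_real_sequentially inf])
  have "(\<lambda>n. real ?h ^ 2 * (1 / ?m n + card (wrong_pairs (G n) (c n)) / ?m n ^ 2)) \<longlonglongrightarrow> real ?h ^ 2 * (0 + 0)"
    by (intro tendsto_intros wrong tendsto_divide_0[OF tendsto_const] minf)
  then have bound: "(\<lambda>n. real ?h ^ 2 * (1 / ?m n + card (wrong_pairs (G n) (c n)) / ?m n ^ 2)) \<longlonglongrightarrow> 0"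
    by simp
  have "\<forall>\<^sub>F n in sequentially. card (pverts (G n)) > 0"
    using inf by (rule eventually_gt_of_filterlim_at_top)
  then have ev: "\<forall>\<^sub>F n in sequentially. \<bar>?e n - ?s n\<bar> \<le>
      real ?h ^ 2 * (1 / ?m n + card (wrong_pairs (G n) (c n)) / ?m n ^ 2)"
  proof eventually_elim
    case (elim n)
    then have m: "?m n > 0" by simp
    have "(?m n + card (wrong_pairs (G n) (c n))) / ?m n ^ 2 = 1 / ?m n + card (wrong_pairs (G n) (c n)) / ?m n ^ 2"
      using m by (simp add: add_divide_distrib power2_eq_square)
    then show ?case
      using card_embeddings_approx[of "G n" H "c n", OF G H c refl m refl] by simp
  qed
  have "(\<lambda>n. \<bar>?e n - ?s n\<bar>) \<longlonglongrightarrow> 0"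
    by (rule tendsto_sandwich[OF _ ev tendsto_const bound]) simp
  then have "(\<lambda>n. ?e n - ?s n) \<longlonglongrightarrow> 0"
    by (rule tendsto_rabs_zero_cancel)
  from tendsto_add[OF this s] show "?e \<longlonglongrightarrow> card (colourings H) / 5 ^ ?h" by simp
qed

section \<open>The partition given by a pentagon\<close>

text \<open>
  \<open>corner E p w i\<close>: the vertex \<open>w\<close> can take the place of \<open>x\<^sub>i\<close> in the pentagon \<open>p\<close>.
\<close>

definition corner :: "('a \<Rightarrow> 'a \<Rightarrow> bool) \<Rightarrow> 'a \<times> 'a \<times> 'a \<times> 'a \<times> 'a \<Rightarrow> 'a \<Rightarrow> nat \<Rightarrow> bool" where
  "corner E p w i \<longleftrightarrow> (case p of (x0,x1,x2,x3,x4) \<Rightarrow>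
     i = 0 \<and> E w x4 \<and> E w x1 \<or> i = 1 \<and> E w x0 \<and> E w x2 \<or> i = 2 \<and> E w x1 \<and> E w x3 \<or>
     i = 3 \<and> E w x2 \<and> E w x4 \<or> i = 4 \<and> E w x3 \<and> E w x0)"

definition unattached :: "'a set \<Rightarrow> ('a \<Rightarrow> 'a \<Rightarrow> bool) \<Rightarrow> 'a \<times> 'a \<times> 'a \<times> 'a \<times> 'a \<Rightarrow> 'a set" where
  "unattached V E p = {w \<in> V. \<forall>i. \<not> corner E p w i}"

text \<open>The default 0 keeps every colour below 5. It is taken only on unattached vertices, which
  form the exceptional set where the colour carries no claim.\<close>

definition corner_colour :: "('a \<Rightarrow> 'a \<Rightarrow> bool) \<Rightarrow> 'a \<times> 'a \<times> 'a \<times> 'a \<times> 'a \<Rightarrow> 'a \<Rightarrow> nat" where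
  "corner_colour E p w = (if \<exists>i. corner E p w i then (SOME i. corner E p w i) else 0)"

lemma corner_corner_colour: "w \<in> V \<Longrightarrow> w \<notin> unattached V E p \<Longrightarrow> corner E p w (corner_colour E p w)"
  by (auto simp: unattached_def corner_colour_def intro: someI)

lemma corner_colour_less: "corner_colour E p w < 5"
proof (cases "\<exists>i. corner E p w i")
  case True
  then have "corner E p w (corner_colour E p w)" unfolding corner_colour_def by (simp add: someI_ex)
  then show ?thesis by (auto simp: corner_def split: prod.splits)
qed (simp add: corner_colour_def)

lemma finite_pentagons: "finite V \<Longrightarrow> finite (pentagons V E)"
  by (rule finite_subset[of _ "V \<times> V \<times> V \<times> V \<times> V"]) (auto simp: pentagons_def)

lemma finite_bad_paths: "finite V \<Longrightarrow> finite (bad_paths V E)"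
  by (rule finite_subset[of _ "V \<times> V \<times> V \<times> V \<times> V"]) (auto simp: bad_paths_def)

text \<open>Two neighbours of w on the pentagon would be consecutive, giving a triangle, or at
  distance two, giving a corner. So w has at most one neighbour there and misses three consecutive
  vertices, which start the required path.\<close>

lemma unattached_bad_path:
  assumes sym: "\<And>x y. E x y = E y x"
    and tri: "\<And>x y z. E x y \<Longrightarrow> E y z \<Longrightarrow> \<not> E x z"
    and p: "(x0,x1,x2,x3,x4) \<in> pentagons V E" and w: "w \<in> unattached V E (x0,x1,x2,x3,x4)"
  shows "(x0,x1,x2,x3,w) \<in> bad_paths V E \<or> (x1,x2,x3,x4,w) \<in> bad_paths V E \<or>
    (x2,x3,x4,x0,w) \<in> bad_paths V E \<or> (x3,x4,x0,x1,w) \<in> bad_paths V E \<or>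
    (x4,x0,x1,x2,w) \<in> bad_paths V E"
proof -
  have V: "x0 \<in> V" "x1 \<in> V" "x2 \<in> V" "x3 \<in> V" "x4 \<in> V" "w \<in> V"
    and E: "E x0 x1" "E x1 x2" "E x2 x3" "E x3 x4" "E x4 x0"
    using p w sym[of x0 x4] by (auto simp: pentagons_def unattached_def)
  have N: "\<not> E x0 x2" "\<not> E x1 x3" "\<not> E x2 x4" "\<not> E x3 x0" "\<not> E x4 x1"
    using E tri by blast+
  have T: "\<not> (E w x0 \<and> E w x1)" "\<not> (E w x1 \<and> E w x2)" "\<not> (E w x2 \<and> E w x3)" "\<not> (E w x3 \<and> E w x4)"
    "\<not> (E w x4 \<and> E w x0)"
    using E tri by blast+
  have C: "\<not> (E w x4 \<and> E w x1)" "\<not> (E w x0 \<and> E w x2)" "\<not> (E w x1 \<and> E w x3)" "\<not> (E w x2 \<and> E w x4)"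
    "\<not> (E w x3 \<and> E w x0)"
    using w by (auto simp: unattached_def corner_def)
  have "\<not> E w x0 \<and> \<not> E w x1 \<and> \<not> E w x2 \<or> \<not> E w x1 \<and> \<not> E w x2 \<and> \<not> E w x3 \<or>
    \<not> E w x2 \<and> \<not> E w x3 \<and> \<not> E w x4 \<or> \<not> E w x3 \<and> \<not> E w x4 \<and> \<not> E w x0 \<or>
    \<not> E w x4 \<and> \<not> E w x0 \<and> \<not> E w x1"
    using T C by blast
  then show ?thesis
    using V E N by (simp add: bad_paths_def sym[of _ w] sym[of x0 x3] sym[of x1 x4]
        sym[of x2 x0] sym[of x3 x1] sym[of x4 x2])
qed

text \<open>Each pair of a pentagon and an unattached vertex yields a bad path in one of five
  rotations, and the pair can be recovered from that path and the omitted pentagon vertex.\<close>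

lemma sum_card_unattached:
  assumes fin: "finite V" and sym: "\<And>x y. E x y = E y x"
    and tri: "\<And>x y z. E x y \<Longrightarrow> E y z \<Longrightarrow> \<not> E x z"
  shows "(\<Sum>p\<in>pentagons V E. card (unattached V E p)) \<le> 5 * (card (bad_paths V E) * card V)"
proof -
  let ?S = "SIGMA p:pentagons V E. unattached V E p" and ?B = "bad_paths V E \<times> V"
  \<comment> \<open>The omitted vertex is kept as the second component; this makes each of the five
    maps injective.\<close>
  define g0 :: "('a \<times> 'a \<times> 'a \<times> 'a \<times> 'a) \<times> 'a \<Rightarrow> ('a \<times> 'a \<times> 'a \<times> 'a \<times> 'a) \<times> 'a"
    where "g0 = (\<lambda>((x0,x1,x2,x3,x4), w). ((x0,x1,x2,x3,w), x4))"
  define g1 :: "('a \<times> 'a \<times> 'a \<times> 'a \<times> 'a) \<times> 'a \<Rightarrow> ('a \<times> 'a \<times> 'a \<times> 'a \<times> 'a) \<times> 'a"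
    where "g1 = (\<lambda>((x0,x1,x2,x3,x4), w). ((x1,x2,x3,x4,w), x0))"
  define g2 :: "('a \<times> 'a \<times> 'a \<times> 'a \<times> 'a) \<times> 'a \<Rightarrow> ('a \<times> 'a \<times> 'a \<times> 'a \<times> 'a) \<times> 'a"
    where "g2 = (\<lambda>((x0,x1,x2,x3,x4), w). ((x2,x3,x4,x0,w), x1))"
  define g3 :: "('a \<times> 'a \<times> 'a \<times> 'a \<times> 'a) \<times> 'a \<Rightarrow> ('a \<times> 'a \<times> 'a \<times> 'a \<times> 'a) \<times> 'a"
    where "g3 = (\<lambda>((x0,x1,x2,x3,x4), w). ((x3,x4,x0,x1,w), x2))"
  define g4 :: "('a \<times> 'a \<times> 'a \<times> 'a \<times> 'a) \<times> 'a \<Rightarrow> ('a \<times> 'a \<times> 'a \<times> 'a \<times> 'a) \<times> 'a"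
    where "g4 = (\<lambda>((x0,x1,x2,x3,x4), w). ((x4,x0,x1,x2,w), x3))"
  have finB: "finite ?B" using fin by (simp add: finite_bad_paths)
  have finS: "finite ?S"
    using fin by (intro finite_SigmaI) (auto simp: finite_pentagons unattached_def)
  have inj: "inj g0" "inj g1" "inj g2" "inj g3" "inj g4"
    by (auto simp: g0_def g1_def g2_def g3_def g4_def inj_def)
  have le: "card {s \<in> ?S. g s \<in> ?B} \<le> card ?B" if "inj g" for g :: "_ \<Rightarrow> ('a \<times> 'a \<times> 'a \<times> 'a \<times> 'a) \<times> 'a"
    by (rule card_inj_on_le[of g]) (use that finB in \<open>auto intro: inj_on_subset\<close>)
  have "?S \<subseteq> {s \<in> ?S. g0 s \<in> ?B} \<union> ({s \<in> ?S. g1 s \<in> ?B} \<union> ({s \<in> ?S. g2 s \<in> ?B} \<union>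
      ({s \<in> ?S. g3 s \<in> ?B} \<union> {s \<in> ?S. g4 s \<in> ?B})))"
  proof
    fix s assume s: "s \<in> ?S"
    obtain x0 x1 x2 x3 x4 w where s_eq: "s = ((x0,x1,x2,x3,x4), w)" by (metis prod.collapse)
    have p: "(x0,x1,x2,x3,x4) \<in> pentagons V E" and w: "w \<in> unattached V E (x0,x1,x2,x3,x4)"
      using s s_eq by auto
    have "x0 \<in> V" "x1 \<in> V" "x2 \<in> V" "x3 \<in> V" "x4 \<in> V" using p by (auto simp: pentagons_def)
    then show "s \<in> {s \<in> ?S. g0 s \<in> ?B} \<union> ({s \<in> ?S. g1 s \<in> ?B} \<union> ({s \<in> ?S. g2 s \<in> ?B} \<union>
      ({s \<in> ?S. g3 s \<in> ?B} \<union> {s \<in> ?S. g4 s \<in> ?B})))"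
      using s unattached_bad_path[OF sym tri p w]
      by (auto simp: s_eq g0_def g1_def g2_def g3_def g4_def)
  qed
  then have "card ?S \<le> card ({s \<in> ?S. g0 s \<in> ?B} \<union> ({s \<in> ?S. g1 s \<in> ?B} \<union> ({s \<in> ?S. g2 s \<in> ?B} \<union>
      ({s \<in> ?S. g3 s \<in> ?B} \<union> {s \<in> ?S. g4 s \<in> ?B}))))"
    by (rule card_mono[rotated]) (use finS in auto)
  also have "\<dots> \<le> card ?B + (card ?B + (card ?B + (card ?B + card ?B)))"
    by (intro order_trans[OF card_Un_le] add_mono le inj)
  finally show ?thesis
    using fin by (simp add: card_SigmaI finite_pentagons unattached_def card_cartesian_product)
qed

text \<open>Some pentagon has at most the average number of unattached vertices; the inequality is
  multiplied by the number of pentagons to stay in the natural numbers.\<close>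

lemma ex_well_attached_pentagon:
  assumes fin: "finite V" and sym: "\<And>x y. E x y = E y x"
    and tri: "\<And>x y z. E x y \<Longrightarrow> E y z \<Longrightarrow> \<not> E x z" and ne: "pentagons V E \<noteq> {}"
  shows "\<exists>p\<in>pentagons V E.
    card (unattached V E p) * card (pentagons V E) \<le> 5 * (card (bad_paths V E) * card V)"
proof (rule ccontr)
  let ?B = "5 * (card (bad_paths V E) * card V)" and ?N = "card (pentagons V E)"
  assume "\<not> ?thesis"
  then have "(\<Sum>p\<in>pentagons V E. ?B) < (\<Sum>p\<in>pentagons V E. card (unattached V E p) * ?N)"
    using ne fin by (intro sum_strict_mono) (auto simp: finite_pentagons not_le)
  also have "\<dots> = (\<Sum>p\<in>pentagons V E. card (unattached V E p)) * ?N"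
    by (simp add: sum_distrib_right)
  also have "\<dots> \<le> ?B * ?N"
    using sum_card_unattached[OF fin sym tri] by (intro mult_right_mono) auto
  finally show False by (simp add: mult.commute)
qed

text \<open>Corners that are equal or at distance two have a common neighbour on the pentagon, which
  would close a triangle with the edge between w and w'.\<close>

lemma corner_adjacent:
  assumes tri: "\<And>x y z. E x y \<Longrightarrow> E y z \<Longrightarrow> \<not> E x z"
    and "corner E p w i" "corner E p w' j" "E w w'"
  shows "(i, j) \<in> parcs cycle5"
proof -
  obtain x0 x1 x2 x3 x4 where p: "p = (x0,x1,x2,x3,x4)" by (metis prod.collapse)
  have "\<not> (E w x \<and> E w' x)" for x using tri[of w w' x] assms(4) by blast
  then show ?thesis using assms(2,3) unfolding corner_def p prod.case cycle5_def by auto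
qed

section \<open>The pentagon as a graph: closed walks, automorphisms and self-homomorphisms\<close>

lemma pair_graph_cycle5: "pair_graph cycle5"
proof (rule pair_graphI)
  show "(v, u) \<in> parcs cycle5" if "(u, v) \<in> parcs cycle5" for u v
    using that by (auto simp: cycle5_def)
qed (auto simp: cycle5_def cycle5_irrefl[unfolded cycle5_def, simplified])

lemma lessThan_5: "{..<5::nat} = {0,1,2,3,4}"
  by (simp add: numeral_eq_Suc lessThan_Suc insert_commute)

lemma pverts_cycle5: "pverts cycle5 = {0,1,2,3,4}"
  by (simp add: cycle5_def lessThan_5)

lemma cycle5_arcs:
  "parcs cycle5 = {(0,1),(0,4),(1,0),(1,2),(2,1),(2,3),(3,2),(3,4),(4,0),(4,3)}"
proof -
  have "parcs cycle5 = {(i, j) \<in> {..<5} \<times> {..<5}. j = (i + 1) mod 5 \<or> i = (j + 1) mod 5}"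
    by (auto simp: cycle5_def)
  also have "\<dots> = set (filter (\<lambda>(i, j). j = (i + 1) mod 5 \<or> i = (j + 1) mod 5)
      (List.product [0..<5] [0..<5]))"
    by (auto simp: lessThan_atLeast0)
  also have "filter (\<lambda>(i, j). j = (i + 1) mod 5 \<or> i = (j + 1) mod 5) (List.product [0..<5] [0..<5])
      = [(0,1),(0,4),(1,0),(1,2),(2,1),(2,3),(3,2),(3,4),(4,0),(4,3::nat)]"
    by code_simp
  finally show ?thesis by simp
qed

lemma triangle_free_cycle5: "triangle_free cycle5"
proof -
  let ?A = "[(0,1),(0,4),(1,0),(1,2),(2,1),(2,3),(3,2),(3,4),(4,0),(4,3::nat)]"
  have "\<forall>a\<in>set ?A. \<forall>b\<in>set ?A. \<forall>c\<in>set ?A. \<not> (snd a = fst b \<and> snd b = fst c \<and> snd c = fst a)"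
    by code_simp
  then have *: "\<forall>a\<in>parcs cycle5. \<forall>b\<in>parcs cycle5. \<forall>c\<in>parcs cycle5.
      \<not> (snd a = fst b \<and> snd b = fst c \<and> snd c = fst a)"
    by (simp only: cycle5_arcs list.set)
  show ?thesis
    unfolding triangle_free_def
  proof clarify
    fix u v w
    assume "(u, v) \<in> parcs cycle5" "(v, w) \<in> parcs cycle5" "(w, u) \<in> parcs cycle5"
    from *[rule_format, OF this] show False by simp
  qed
qed

lemma triangle_freeD:
  assumes G: "pair_graph G" and tf: "triangle_free G"
  shows "(x, y) \<in> parcs G \<Longrightarrow> (y, z) \<in> parcs G \<Longrightarrow> (x, z) \<notin> parcs G"
  using tf pair_graph_sym[OF G, of x z] unfolding triangle_free_def by blast

text \<open>A chord of a closed 5-walk would close a triangle, and two equal vertices at distance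
  two would turn an edge of the walk into such a chord.\<close>

lemma bij_betw_embeddings_cycle5:
  assumes G: "pair_graph G" and tf: "triangle_free G"
  shows "bij_betw (\<lambda>f. (f 0, f 1, f 2, f 3, f 4)) (embeddings cycle5 G)
    (pentagons (pverts G) (\<lambda>u v. (u, v) \<in> parcs G))"
proof (rule bij_betw_byWitness[where f' = "\<lambda>(x0,x1,x2,x3,x4). (\<lambda>i\<in>{..<5::nat}. [x0,x1,x2,x3,x4] ! i)"])
  let ?E = "\<lambda>u v. (u, v) \<in> parcs G"
  show "\<forall>f\<in>embeddings cycle5 G. (case (f 0, f 1, f 2, f 3, f 4) of (x0,x1,x2,x3,x4) \<Rightarrow>
      (\<lambda>i\<in>{..<5::nat}. [x0,x1,x2,x3,x4] ! i)) = f"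
  proof (intro ballI ext)
    fix f i assume "f \<in> embeddings cycle5 G"
    then have f: "f \<in> extensional {..<5::nat}" by (auto simp: embeddings_def PiE_def cycle5_def)
    show "(case (f 0, f 1, f 2, f 3, f 4) of (x0,x1,x2,x3,x4) \<Rightarrow>
      (\<lambda>i\<in>{..<5::nat}. [x0,x1,x2,x3,x4] ! i)) i = f i"
    proof (cases "i \<in> {..<5}")
      case True
      then have "i = 0 \<or> i = 1 \<or> i = 2 \<or> i = 3 \<or> i = 4" unfolding lessThan_5 by simp
      then show ?thesis by (elim disjE) simp_all
    next
      case False
      then show ?thesis using f by (simp add: extensional_def)
    qed
  qed
  show "\<forall>p\<in>pentagons (pverts G) ?E.
      (\<lambda>f. (f 0, f 1, f 2, f 3, f 4)) (case p of (x0,x1,x2,x3,x4) \<Rightarrow>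
      (\<lambda>i\<in>{..<5::nat}. [x0,x1,x2,x3,x4] ! i)) = p"
  proof
    fix p :: "'a \<times> 'a \<times> 'a \<times> 'a \<times> 'a"
    obtain x0 x1 x2 x3 x4 where "p = (x0,x1,x2,x3,x4)" by (metis prod.collapse)
    then show "(\<lambda>f. (f 0, f 1, f 2, f 3, f 4)) (case p of (x0,x1,x2,x3,x4) \<Rightarrow>
      (\<lambda>i\<in>{..<5::nat}. [x0,x1,x2,x3,x4] ! i)) = p" by simp
  qed
  show "(\<lambda>f. (f 0, f 1, f 2, f 3, f 4)) ` embeddings cycle5 G \<subseteq> pentagons (pverts G) ?E"
  proof (rule image_subsetI)
    fix f assume f: "f \<in> embeddings cycle5 G"
    have "(f i, f j) \<in> parcs G" if "(i, j) \<in> parcs cycle5" for i j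
      using f that pair_graph_arcD[OF pair_graph_cycle5 that] by (auto simp: embeddings_def)
    moreover have "f i \<in> pverts G" if "i \<in> {0,1,2,3,4}" for i
      using f that unfolding pverts_cycle5[symmetric] by (auto simp: embeddings_def)
    ultimately show "(f 0, f 1, f 2, f 3, f 4) \<in> pentagons (pverts G) ?E"
      by (simp add: pentagons_def cycle5_arcs)
  qed
  show "(\<lambda>(x0,x1,x2,x3,x4). (\<lambda>i\<in>{..<5::nat}. [x0,x1,x2,x3,x4] ! i)) ` pentagons (pverts G) ?E
      \<subseteq> embeddings cycle5 G"
  proof (clarsimp simp: pentagons_def)
    fix x0 x1 x2 x3 x4
    assume V: "x0 \<in> pverts G" "x1 \<in> pverts G" "x2 \<in> pverts G" "x3 \<in> pverts G" "x4 \<in> pverts G"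
      and E: "?E x0 x1" "?E x1 x2" "?E x2 x3" "?E x3 x4" "?E x0 x4"
    have E': "?E x1 x0" "?E x2 x1" "?E x3 x2" "?E x4 x3" "?E x4 x0"
      using E pair_graph_sym[OF G] by blast+
    have N: "\<not> ?E x0 x2" "\<not> ?E x1 x3" "\<not> ?E x2 x4" "\<not> ?E x3 x0" "\<not> ?E x4 x1"
      "\<not> ?E x2 x0" "\<not> ?E x3 x1" "\<not> ?E x4 x2" "\<not> ?E x0 x3" "\<not> ?E x1 x4"
      using triangle_freeD[OF G tf] E E' by blast+
    have L: "\<not> ?E x x" for x by (rule pair_graph_irrefl[OF G])
    have D: "x0 \<noteq> x1" "x1 \<noteq> x2" "x2 \<noteq> x3" "x3 \<noteq> x4" "x0 \<noteq> x4"
      "x0 \<noteq> x2" "x1 \<noteq> x3" "x2 \<noteq> x4" "x0 \<noteq> x3" "x1 \<noteq> x4"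
      using E E' N L by auto
    show "(\<lambda>i\<in>{..<5::nat}. [x0,x1,x2,x3,x4] ! i) \<in> embeddings cycle5 G"
      unfolding embeddings_def pverts_cycle5 cycle5_arcs
      using V E E' N L D D[symmetric] by (simp add: inj_on_def lessThan_5 PiE_def Pi_def)
  qed
qed

lemma card_embeddings_cycle5:
  assumes "pair_graph G" "triangle_free G"
  shows "card (embeddings cycle5 G) = card (pentagons (pverts G) (\<lambda>u v. (u, v) \<in> parcs G))"
  by (rule bij_betw_same_card[OF bij_betw_embeddings_cycle5[OF assms]])

text \<open>This is the factor that turns the density 5!/5^5 into the embedding density 10/5^5, and
  the number of colour patterns a pentagon can have.\<close>

lemma card_automorphisms_cycle5: "card (embeddings cycle5 cycle5) = 10"
proof -
  let ?A = "[(0,1),(0,4),(1,0),(1,2),(2,1),(2,3),(3,2),(3,4),(4,0),(4,3::nat)]"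
  let ?R = "[(0::nat,1::nat,2::nat,3::nat,4::nat),(0,4,3,2,1),(1,2,3,4,0),(1,0,4,3,2),(2,3,4,0,1),
    (2,1,0,4,3),(3,4,0,1,2),(3,2,1,0,4),(4,0,1,2,3),(4,3,2,1,0)]"
  let ?E = "\<lambda>u v. (u, v) \<in> parcs cycle5"
  have A: "parcs cycle5 = set ?A"
    by (simp only: cycle5_arcs list.set)
  \<comment> \<open>Testing each junction before the next quantifier restricts the evaluation to
    walks instead of all 10^5 sequences of arcs.\<close>
  have walks: "\<forall>a\<in>set ?A. \<forall>b\<in>set ?A. if snd a = fst b then (\<forall>c\<in>set ?A. if snd b = fst c then
      (\<forall>d\<in>set ?A. if snd c = fst d then (\<forall>e\<in>set ?A. if snd d = fst e then
        if snd e = fst a then (fst a, fst b, fst c, fst d, fst e) \<in> set ?R else True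
      else True) else True) else True) else True"
    by code_simp
  have "pentagons (pverts cycle5) ?E = set ?R"
  proof
    show "pentagons (pverts cycle5) ?E \<subseteq> set ?R"
    proof
      fix p :: "nat \<times> nat \<times> nat \<times> nat \<times> nat"
      obtain x0 x1 x2 x3 x4 where p: "p = (x0,x1,x2,x3,x4)" by (metis prod.collapse)
      assume "p \<in> pentagons (pverts cycle5) ?E"
      then have E: "?E x0 x1" "?E x1 x2" "?E x2 x3" "?E x3 x4" "?E x4 x0"
        using pair_graph_sym[OF pair_graph_cycle5] by (simp_all add: p pentagons_def)
      then have "(x0, x1) \<in> set ?A" "(x1, x2) \<in> set ?A" "(x2, x3) \<in> set ?A" "(x3, x4) \<in> set ?A"
        "(x4, x0) \<in> set ?A"
        by (simp_all only: A)
      note mem = this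
      from walks[THEN bspec, OF mem(1), THEN bspec, OF mem(2), unfolded fst_conv snd_conv if_P[OF refl],
        THEN bspec, OF mem(3), unfolded fst_conv snd_conv if_P[OF refl],
        THEN bspec, OF mem(4), unfolded fst_conv snd_conv if_P[OF refl],
        THEN bspec, OF mem(5), unfolded fst_conv snd_conv if_P[OF refl]]
      show "p \<in> set ?R" unfolding p .
    qed
    have "\<forall>(x0,x1,x2,x3,x4)\<in>set ?R. x0 \<in> set [0,1,2,3,4::nat] \<and> x1 \<in> set [0,1,2,3,4::nat] \<and>
        x2 \<in> set [0,1,2,3,4::nat] \<and> x3 \<in> set [0,1,2,3,4::nat] \<and> x4 \<in> set [0,1,2,3,4::nat] \<and>
        (x0, x1) \<in> set ?A \<and> (x1, x2) \<in> set ?A \<and> (x2, x3) \<in> set ?A \<and> (x3, x4) \<in> set ?A \<and> (x0, x4) \<in> set ?A"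
      by code_simp
    moreover have "pverts cycle5 = set [0,1,2,3,4::nat]"
      by (simp only: pverts_cycle5 list.set)
    ultimately show "set ?R \<subseteq> pentagons (pverts cycle5) ?E"
      unfolding pentagons_def A case_prod_unfold by (simp only: subset_iff mem_Collect_eq mem_Times_iff) metis
  qed
  moreover have "distinct ?R" by code_simp
  ultimately have "card (pentagons (pverts cycle5) ?E) = length ?R"
    by (simp only: distinct_card)
  then show ?thesis
    unfolding card_embeddings_cycle5[OF pair_graph_cycle5 triangle_free_cycle5] by simp
qed

text \<open>The images of 0, ..., 4 form a closed 5-walk in the triangle-free graph
  \<open>cycle5\<close>, hence an induced pentagon; preserving arcs thus already forces injectivity
  and reflection of arcs.\<close>

lemma hom_cycle5_in_embeddings:
  assumes c: "c \<in> {..<5} \<rightarrow>\<^sub>E {..<5}"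
    and hom: "\<And>u v. (u, v) \<in> parcs cycle5 \<Longrightarrow> (c u, c v) \<in> parcs cycle5"
  shows "c \<in> embeddings cycle5 cycle5"
proof -
  let ?t = "\<lambda>f. (f 0, f 1, f 2, f 3, f 4)"
  have "?t c \<in> pentagons (pverts cycle5) (\<lambda>u v. (u, v) \<in> parcs cycle5)"
  proof -
    have "(c i, c j) \<in> parcs cycle5"
      if "(i, j) \<in> {(0,1),(1,2),(2,3),(3,4),(0,4)}" for i j
      by (rule hom) (use that in \<open>auto simp: cycle5_arcs\<close>)
    moreover have "c i \<in> pverts cycle5" if "i \<in> {..<5}" for i
      using c that by (auto simp: cycle5_def PiE_def Pi_def)
    ultimately show ?thesis by (simp add: pentagons_def)
  qed
  then have "?t c \<in> ?t ` embeddings cycle5 cycle5"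
    using bij_betw_embeddings_cycle5[OF pair_graph_cycle5 triangle_free_cycle5]
    by (simp only: bij_betw_def)
  then obtain f where f: "f \<in> embeddings cycle5 cycle5" "?t c = ?t f"
    by (rule imageE)
  have "f = c"
  proof
    fix i
    show "f i = c i"
    proof (cases "i \<in> {..<5}")
      case True
      then have "i = 0 \<or> i = 1 \<or> i = 2 \<or> i = 3 \<or> i = 4" unfolding lessThan_5 by simp
      then show ?thesis using f(2) by (elim disjE) simp_all
    next
      case False
      then show ?thesis using c f(1) by (simp add: embeddings_def cycle5_def PiE_def extensional_def)
    qed
  qed
  then show ?thesis using f by simp
qed

lemma colourings_cycle5: "colourings cycle5 = embeddings cycle5 cycle5"
proof
  have V: "pverts cycle5 = {..<5}" by (simp add: cycle5_def)
  show "embeddings cycle5 cycle5 \<subseteq> colourings cycle5"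
    by (auto simp: embeddings_def colourings_def V)
  show "colourings cycle5 \<subseteq> embeddings cycle5 cycle5"
  proof
    fix c assume c: "c \<in> colourings cycle5"
    then have cV: "c \<in> {..<5} \<rightarrow>\<^sub>E {..<5}"
      and iff: "\<And>u v. u \<in> {..<5} \<Longrightarrow> v \<in> {..<5} \<Longrightarrow>
        (c u, c v) \<in> parcs cycle5 \<longleftrightarrow> (u, v) \<in> parcs cycle5"
      by (auto simp: colourings_def V)
    show "c \<in> embeddings cycle5 cycle5"
    proof (rule hom_cycle5_in_embeddings[OF cV])
      fix u v assume uv: "(u, v) \<in> parcs cycle5"
      then have "u \<in> {..<5} \<and> v \<in> {..<5}"
        using pair_graph_arcD[OF pair_graph_cycle5] V by blast
      then show "(c u, c v) \<in> parcs cycle5" using iff uv by blast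
    qed
  qed
qed

section \<open>Counting pentagons and wrong pairs in a coloured graph with exceptional set U\<close>

lemma card_PiE_one:
  assumes "finite I" "a \<in> I" "h = card I"
  shows "card {f \<in> I \<rightarrow>\<^sub>E A. f a \<in> B} = card (A \<inter> B) * card A ^ (h - 1)"
proof -
  have "{f \<in> I \<rightarrow>\<^sub>E A. f a \<in> B} = PiE I (\<lambda>j. if j = a then A \<inter> B else A)"
  proof (intro set_eqI iffI)
    fix f assume "f \<in> PiE I (\<lambda>j. if j = a then A \<inter> B else A)"
    then show "f \<in> {f \<in> I \<rightarrow>\<^sub>E A. f a \<in> B}"
      using assms(2) by (auto simp: PiE_iff split: if_splits)
  qed (use assms(2) in \<open>auto simp: PiE_iff\<close>)
  then have "card {f \<in> I \<rightarrow>\<^sub>E A. f a \<in> B} = (\<Prod>j\<in>I. card (if j = a then A \<inter> B else A))"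
    using assms(1) by (simp add: card_PiE)
  also have "\<dots> = card (A \<inter> B) * (\<Prod>j\<in>I - {a}. card (if j = a then A \<inter> B else A))"
    using assms by (subst prod.remove[of _ a]) auto
  also have "(\<Prod>j\<in>I - {a}. card (if j = a then A \<inter> B else A)) = (\<Prod>j\<in>I - {a}. card A)"
    by (rule prod.cong) auto
  finally show ?thesis using assms by simp
qed

definition class_edges :: "'a pair_pre_digraph \<Rightarrow> ('a \<Rightarrow> nat) \<Rightarrow> nat \<Rightarrow> nat \<Rightarrow> nat" where
  "class_edges G c i j = card {(x, y) \<in> colour_class G c i \<times> colour_class G c j. (x, y) \<in> parcs G}"

lemma pverts_cycle5_lessThan: "pverts cycle5 = {..<5}"
  by (simp add: cycle5_def)

text \<open>A colouring of the pentagon is an automorphism, so some arc (a, b) is sent to (i, j).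
  Only the adjacency along that arc is kept; the other three vertices range freely over their
  classes.\<close>

lemma card_class_homs:
  assumes G: "finite (pverts G)" and arc: "(i, j) \<in> parcs cycle5" and col: "col \<in> colourings cycle5"
  shows "card {f \<in> PiE {..<5} (\<lambda>u. colour_class G c (col u)).
      \<forall>u v. (u, v) \<in> parcs cycle5 \<longrightarrow> (f u, f v) \<in> parcs G} \<le>
    class_edges G c i j * (\<Prod>k\<in>{..<5} - {i, j}. card (colour_class G c k))"
proof -
  let ?C = "\<lambda>u. colour_class G c (col u)"
  have colV: "col \<in> {..<5} \<rightarrow>\<^sub>E {..<5}" and inj: "inj_on col {..<5}"
    and iff: "\<And>u v. u \<in> {..<5} \<Longrightarrow> v \<in> {..<5} \<Longrightarrow>
        (col u, col v) \<in> parcs cycle5 \<longleftrightarrow> (u, v) \<in> parcs cycle5"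
    using col by (auto simp: colourings_cycle5 embeddings_def pverts_cycle5_lessThan)
  have bij: "bij_betw col {..<5} {..<5}"
    using inj colV endo_inj_surj[of "{..<5}" col] by (auto simp: bij_betw_def)
  have ij: "i \<in> {..<5}" "j \<in> {..<5}" "i \<noteq> j"
    using pair_graph_arcD[OF pair_graph_cycle5 arc] arc pair_graph_irrefl[OF pair_graph_cycle5]
    by (auto simp: pverts_cycle5_lessThan)
  then have "i \<in> col ` {..<5}" "j \<in> col ` {..<5}" using bij by (simp_all add: bij_betw_def)
  then obtain a b where ab: "a \<in> {..<5}" "b \<in> {..<5}" "col a = i" "col b = j" "a \<noteq> b"
    using ij(3) by (elim imageE) auto
  have ab_arc: "(a, b) \<in> parcs cycle5" using iff ab arc by blast
  have finC: "finite (PiE {..<5} ?C)"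
    using G by (intro finite_PiE) (auto simp: colour_class_def)
  have "card {f \<in> PiE {..<5} ?C. \<forall>u v. (u, v) \<in> parcs cycle5 \<longrightarrow> (f u, f v) \<in> parcs G}
      \<le> card {f \<in> PiE {..<5} ?C. (f a, f b) \<in> parcs G}"
    using ab_arc finC by (intro card_mono) auto
  also have "\<dots> = card {(x, y) \<in> ?C a \<times> ?C b. (x, y) \<in> parcs G} * (\<Prod>u\<in>{..<5} - {a, b}. card (?C u))"
    by (rule card_PiE_pair[of _ _ _ _ "\<lambda>x y. (x, y) \<in> parcs G"]) (use ab in auto)
  also have "(\<Prod>u\<in>{..<5} - {a, b}. card (?C u)) = (\<Prod>k\<in>{..<5} - {i, j}. card (colour_class G c k))"
  proof (rule prod.reindex_bij_betw)
    have "bij_betw col {a, b} {i, j}"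
      using ab ij by (simp add: bij_betw_def)
    then show "bij_betw col ({..<5} - {a, b}) ({..<5} - {i, j})"
      using ab ij by (intro bij_betw_DiffI[OF bij]) auto
  qed
  finally show ?thesis using ab by (simp add: class_edges_def)
qed

text \<open>A pentagon meets U, in one of five positions, or its colours form a homomorphism of the
  pentagon to itself, which is one of ten automorphisms. Singling out one arc (i, j) makes a
  shortage of edges between these two classes visible.\<close>

lemma card_pentagon_embeddings_le:
  assumes G: "pair_graph G" and c: "\<And>v. v \<in> pverts G \<Longrightarrow> c v < 5" and U: "U \<subseteq> pverts G"
    and edges: "\<And>x y. x \<in> pverts G - U \<Longrightarrow> y \<in> pverts G - U \<Longrightarrow> (x, y) \<in> parcs G \<Longrightarrow>
      (c x, c y) \<in> parcs cycle5"
    and arc: "(i, j) \<in> parcs cycle5"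
  shows "card (embeddings cycle5 G) \<le> 5 * (card U * card (pverts G) ^ 4) +
    10 * (class_edges G c i j * (\<Prod>k\<in>{..<5} - {i, j}. card (colour_class G c k)))"
proof -
  let ?V = "pverts G" and ?T = "{..<5::nat} \<rightarrow>\<^sub>E pverts G"
  let ?A = "\<lambda>u. {f \<in> ?T. f u \<in> U}"
  let ?B = "\<lambda>col. {f \<in> PiE {..<5} (\<lambda>u. colour_class G c (col u)).
      \<forall>u v. (u, v) \<in> parcs cycle5 \<longrightarrow> (f u, f v) \<in> parcs G}"
  let ?m = "class_edges G c i j * (\<Prod>k\<in>{..<5} - {i, j}. card (colour_class G c k))"
  have finV: "finite ?V" by (rule pair_graph_finite[OF G])
  have fincol: "finite (colourings cycle5)"
    by (rule finite_colourings) (simp add: pverts_cycle5_lessThan)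
  have finA: "finite (\<Union>u<5. ?A u)" using finV by (auto intro!: finite_PiE)
  have finB: "finite (\<Union>col\<in>colourings cycle5. ?B col)"
  proof (intro finite_UN_I fincol)
    fix col
    have "finite (PiE {..<5::nat} (\<lambda>u. colour_class G c (col u)))"
      using finV by (intro finite_PiE) (auto simp: colour_class_def)
    then show "finite (?B col)" by simp
  qed
  have "embeddings cycle5 G \<subseteq> (\<Union>u<5. ?A u) \<union> (\<Union>col\<in>colourings cycle5. ?B col)"
  proof
    fix f assume "f \<in> embeddings cycle5 G"
    then have f: "f \<in> ?T" and iff: "\<And>u v. u \<in> {..<5} \<Longrightarrow> v \<in> {..<5} \<Longrightarrow>
        (f u, f v) \<in> parcs G \<longleftrightarrow> (u, v) \<in> parcs cycle5"
      by (auto simp: embeddings_def pverts_cycle5_lessThan)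
    have fV: "f u \<in> ?V" if "u < 5" for u using f that by auto
    have arcf: "(f u, f v) \<in> parcs G \<and> u < 5 \<and> v < 5" if "(u, v) \<in> parcs cycle5" for u v
      using iff that pair_graph_arcD[OF pair_graph_cycle5 that] by (auto simp: pverts_cycle5_lessThan)
    show "f \<in> (\<Union>u<5. ?A u) \<union> (\<Union>col\<in>colourings cycle5. ?B col)"
    proof (cases "\<exists>u<5. f u \<in> U")
      case True
      then show ?thesis using f by auto
    next
      case False
      define col where "col = restrict (c \<circ> f) {..<5}"
      have "col \<in> embeddings cycle5 cycle5"
      proof (rule hom_cycle5_in_embeddings)
        show "col \<in> {..<5} \<rightarrow>\<^sub>E {..<5}" using c fV by (auto simp: col_def)
        fix u v assume uv: "(u, v) \<in> parcs cycle5"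
        have "(c (f u), c (f v)) \<in> parcs cycle5"
          using arcf[OF uv] fV False by (intro edges) auto
        then show "(col u, col v) \<in> parcs cycle5" using arcf[OF uv] by (simp add: col_def)
      qed
      moreover have "f \<in> ?B col"
        using f arcf by (auto simp: col_def colour_class_def PiE_iff)
      ultimately show ?thesis unfolding colourings_cycle5 by blast
    qed
  qed
  then have "card (embeddings cycle5 G) \<le> card ((\<Union>u<5. ?A u) \<union> (\<Union>col\<in>colourings cycle5. ?B col))"
    by (rule card_mono[rotated]) (use finA finB in simp)
  also have "\<dots> \<le> card (\<Union>u<5. ?A u) + card (\<Union>col\<in>colourings cycle5. ?B col)"
    by (rule card_Un_le)
  also have "\<dots> \<le> (\<Sum>u<5. card (?A u)) + (\<Sum>col\<in>colourings cycle5. card (?B col))"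
    by (intro add_mono card_UN_le fincol finite_lessThan)
  also have "\<dots> \<le> (\<Sum>u<5::nat. card U * card ?V ^ 4) + (\<Sum>col\<in>colourings cycle5. ?m)"
  proof (intro add_mono sum_mono)
    fix u :: nat assume "u \<in> {..<5}"
    then show "card (?A u) \<le> card U * card ?V ^ 4"
      using card_PiE_one[of "{..<5}" u 5 ?V U] U by (simp add: Int_absorb1)
  qed (rule card_class_homs[OF finV arc])
  also have "\<dots> = 5 * (card U * card ?V ^ 4) + 10 * ?m"
    using card_automorphisms_cycle5 by (simp add: colourings_cycle5)
  finally show ?thesis .
qed

text \<open>Pairs meeting U number at most 2 |U| n. Elsewhere there are no surplus edges, so a wrong
  pair is a missing edge between consecutive classes. Pairs are ordered, hence the sum over all ten
  arcs.\<close>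

lemma card_wrong_pairs_le:
  assumes G: "pair_graph G" and c: "\<And>v. v \<in> pverts G \<Longrightarrow> c v < 5" and U: "U \<subseteq> pverts G"
    and edges: "\<And>x y. x \<in> pverts G - U \<Longrightarrow> y \<in> pverts G - U \<Longrightarrow> (x, y) \<in> parcs G \<Longrightarrow>
      (c x, c y) \<in> parcs cycle5"
  shows "real (card (wrong_pairs G c)) \<le> 2 * (real (card U) * card (pverts G)) +
    (\<Sum>(i, j)\<in>parcs cycle5. real (card (colour_class G c i)) * card (colour_class G c j) - class_edges G c i j)"
proof -
  let ?V = "pverts G" and ?C = "colour_class G c"
  let ?M = "\<lambda>a. {(x, y) \<in> ?C (fst a) \<times> ?C (snd a). (x, y) \<notin> parcs G}"
  have finV: "finite ?V" by (rule pair_graph_finite[OF G])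
  have finC: "finite (?C i)" for i using finV by (simp add: colour_class_def)
  have finU: "finite U" using U finV by (rule finite_subset)
  have finA: "finite (parcs cycle5)" by (simp add: cycle5_arcs)
  have finM: "finite (?M a)" for a
    by (rule finite_subset[of _ "?C (fst a) \<times> ?C (snd a)"]) (auto simp: finC)
  have M: "real (card (?M a)) = real (card (?C (fst a))) * card (?C (snd a)) - class_edges G c (fst a) (snd a)" for a
  proof -
    let ?E = "{(x, y) \<in> ?C (fst a) \<times> ?C (snd a). (x, y) \<in> parcs G}"
    have "card (?C (fst a) \<times> ?C (snd a)) = card (?E \<union> ?M a)"
      by (rule arg_cong[where f = card]) auto
    also have "\<dots> = card ?E + card (?M a)"
    proof (rule card_Un_disjoint)
      show "finite ?E"
        by (rule finite_subset[of _ "?C (fst a) \<times> ?C (snd a)"]) (auto simp: finC)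
      show "finite (?M a)" by (rule finM)
    qed auto
    finally show ?thesis
      by (simp add: class_edges_def card_cartesian_product flip: of_nat_mult)
  qed
  have "wrong_pairs G c \<subseteq> U \<times> ?V \<union> (?V \<times> U \<union> (\<Union>a\<in>parcs cycle5. ?M a))"
  proof
    fix p assume p: "p \<in> wrong_pairs G c"
    obtain x y where xy: "p = (x, y)" by (cases p)
    then have V: "x \<in> ?V" "y \<in> ?V" and w: "((x, y) \<in> parcs G) \<noteq> ((c x, c y) \<in> parcs cycle5)"
      using p by (auto simp: wrong_pairs_def)
    show "p \<in> U \<times> ?V \<union> (?V \<times> U \<union> (\<Union>a\<in>parcs cycle5. ?M a))"
    proof (cases "x \<in> U \<or> y \<in> U")
      case True
      then show ?thesis using V xy by blast
    next
      case False
      then have "(x, y) \<notin> parcs G" "(c x, c y) \<in> parcs cycle5" using w V edges by auto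
      moreover from this have "p \<in> ?M (c x, c y)" using V xy by (simp add: colour_class_def)
      ultimately show ?thesis by blast
    qed
  qed
  then have "card (wrong_pairs G c) \<le> card (U \<times> ?V \<union> (?V \<times> U \<union> (\<Union>a\<in>parcs cycle5. ?M a)))"
    by (rule card_mono[rotated]) (use finU finV finA finM in simp)
  also have "\<dots> \<le> card (U \<times> ?V) + (card (?V \<times> U) + card (\<Union>a\<in>parcs cycle5. ?M a))"
    by (intro order_trans[OF card_Un_le] add_left_mono card_Un_le)
  also have "\<dots> \<le> card (U \<times> ?V) + (card (?V \<times> U) + (\<Sum>a\<in>parcs cycle5. card (?M a)))"
    by (intro add_left_mono card_UN_le finA)
  finally have "real (card (wrong_pairs G c)) \<le>
      real (card (U \<times> ?V) + (card (?V \<times> U) + (\<Sum>a\<in>parcs cycle5. card (?M a))))"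
    by (simp only: of_nat_le_iff)
  also have "\<dots> = 2 * (real (card U) * card ?V) + (\<Sum>a\<in>parcs cycle5. real (card (?M a)))"
    by (simp add: card_cartesian_product)
  finally show ?thesis
    unfolding M by (simp only: case_prod_unfold)
qed

section \<open>Stability\<close>

lemma amgm4:
  fixes a b c d :: real
  assumes "a \<ge> 0" "b \<ge> 0" "c \<ge> 0" "d \<ge> 0"
  shows "a * b * c * d \<le> ((a + b + c + d) / 4) ^ 4"
proof -
  have am2: "x * y \<le> ((x + y) / 2)\<^sup>2" for x y :: real
    using zero_le_power2[of "x - y"] by (simp add: power2_eq_square field_simps)
  have "a * b * c * d = (a * b) * (c * d)" by simp
  also have "\<dots> \<le> ((a + b) / 2)\<^sup>2 * ((c + d) / 2)\<^sup>2"
    using assms by (intro mult_mono am2) auto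
  also have "\<dots> = (((a + b) / 2) * ((c + d) / 2))\<^sup>2" by (simp only: power_mult_distrib)
  also have "\<dots> \<le> ((((a + b) / 2 + (c + d) / 2) / 2)\<^sup>2)\<^sup>2"
    using assms by (intro power_mono am2) auto
  also have "\<dots> = ((a + b + c + d) / 4) ^ 4"
    by (simp add: add_divide_distrib add.assoc)
  finally show ?thesis .
qed

text \<open>The left side is maximal at x = 1/5. The difference of the two sides has a double zero
  there and, with 2000, also a zero at x = 1, so this constant cannot be lowered; the remaining
  quadratic factor is a square plus 23/4.\<close>

lemma quintic_stability:
  fixes x :: real
  assumes "0 \<le> x" "x \<le> 1"
  shows "x * ((1 - x) / 4) ^ 4 \<le> 1 / 5 ^ 5 - (x - 1 / 5)\<^sup>2 / 2000"
proof -
  have "0 \<le> 5 * (5 * x - 1)\<^sup>2 * ((1 - x) * ((5 * x - 13/2)\<^sup>2 + 23/4))"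
    using assms by (intro mult_nonneg_nonneg add_nonneg_nonneg) auto
  also have "\<dots> = 256 - 16 * (5 * x - 1)\<^sup>2 - 3125 * (x * (1 - x) ^ 4)"
    by (simp add: eval_nat_numeral algebra_simps)
  finally have "3125 * (x * (1 - x) ^ 4) \<le> 256 - 16 * (5 * x - 1)\<^sup>2" by simp
  moreover have "x * ((1 - x) / 4) ^ 4 = x * (1 - x) ^ 4 / 256"
    by (simp add: power_divide)
  moreover have "(x - 1 / 5)\<^sup>2 = (5 * x - 1)\<^sup>2 / 25"
    by (simp add: power2_eq_square field_simps)
  ultimately show ?thesis by (simp add: field_simps)
qed

text \<open>The arithmetic-geometric mean inequality for the other four sizes, whose sum is 1 - x_i,
  leaves the one-variable bound.\<close>

lemma class_product_bound:
  fixes x :: "nat \<Rightarrow> real"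
  assumes x: "\<And>i. 0 \<le> x i" and sum: "(\<Sum>i<5. x i) = 1" and i: "i < 5"
  shows "(\<Prod>k<5. x k) \<le> 1 / 5 ^ 5 - (x i - 1 / 5)\<^sup>2 / 2000"
proof -
  have P: "(\<Prod>k<5. x k) = x 0 * x 1 * x 2 * x 3 * x 4"
    by (simp add: lessThan_5 mult.assoc)
  have S: "x 0 + x 1 + x 2 + x 3 + x 4 = 1"
    using sum by (simp add: lessThan_5 add.assoc)
  have key: "x j * (a * b * c * d) \<le> 1 / 5 ^ 5 - (x j - 1 / 5)\<^sup>2 / 2000"
    if "a \<ge> 0" "b \<ge> 0" "c \<ge> 0" "d \<ge> 0" "a + b + c + d = 1 - x j" for a b c d j
  proof -
    have "x j * (a * b * c * d) \<le> x j * ((1 - x j) / 4) ^ 4"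
      using amgm4[OF that(1-4)] that(5) x by (intro mult_left_mono) auto
    also have "\<dots> \<le> 1 / 5 ^ 5 - (x j - 1 / 5)\<^sup>2 / 2000"
      using x[of j] that by (intro quintic_stability) auto
    finally show ?thesis .
  qed
  have "i = 0 \<or> i = 1 \<or> i = 2 \<or> i = 3 \<or> i = 4" using i by auto
  then show ?thesis
    unfolding P
    using S key[OF x[of 1] x[of 2] x[of 3] x[of 4], of 0] key[OF x[of 0] x[of 2] x[of 3] x[of 4], of 1]
      key[OF x[of 0] x[of 1] x[of 3] x[of 4], of 2] key[OF x[of 0] x[of 1] x[of 2] x[of 4], of 3]
      key[OF x[of 0] x[of 1] x[of 2] x[of 3], of 4]
    by (elim disjE) (simp_all add: mult_ac)
qed

lemma sum_class_fractions:
  assumes "finite (pverts G)" "\<And>v. v \<in> pverts G \<Longrightarrow> c v < 5" "card (pverts G) > 0"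
  shows "(\<Sum>i<5. card (colour_class G c i) / real (card (pverts G))) = 1"
proof -
  have "card (pverts G) = card (\<Union>i<5. colour_class G c i)"
    using assms(2) by (intro arg_cong[where f = card]) (auto simp: colour_class_def)
  also have "\<dots> = (\<Sum>i<5. card (colour_class G c i))"
    using assms(1) by (intro card_UN_disjoint) (auto simp: colour_class_def)
  finally have "(\<Sum>i<5. real (card (colour_class G c i))) = card (pverts G)" by simp
  then show ?thesis using assms(3) by (simp flip: sum_divide_distrib)
qed

lemma card_minus_arc:
  assumes "(i, j) \<in> parcs cycle5"
  shows "card ({..<5} - {i, j}) = 3" "i < 5" "j < 5" "i \<noteq> j"
proof -
  show ij: "i < 5" "j < 5" "i \<noteq> j"
    using pair_graph_arcD[OF pair_graph_cycle5 assms] assms pair_graph_irrefl[OF pair_graph_cycle5]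
    by (auto simp: pverts_cycle5_lessThan)
  show "card ({..<5} - {i, j}) = 3"
    using ij by (subst card_Diff_subset) auto
qed

lemma pentagon_density_bound:
  fixes n :: real
  assumes G: "pair_graph G" and c: "\<And>v. v \<in> pverts G \<Longrightarrow> c v < 5" and U: "U \<subseteq> pverts G"
    and edges: "\<And>x y. x \<in> pverts G - U \<Longrightarrow> y \<in> pverts G - U \<Longrightarrow> (x, y) \<in> parcs G \<Longrightarrow>
      (c x, c y) \<in> parcs cycle5"
    and arc: "(i, j) \<in> parcs cycle5" and n: "n = real (card (pverts G))" "n > 0"
  shows "card (embeddings cycle5 G) / n ^ 5 \<le> 5 * (card U / n) +
    10 * (class_edges G c i j / n ^ 2 * (\<Prod>k\<in>{..<5} - {i, j}. card (colour_class G c k) / n))"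
proof -
  let ?P = "\<Prod>k\<in>{..<5} - {i, j}. real (card (colour_class G c k))"
  have "real (card (embeddings cycle5 G)) \<le> real (5 * (card U * card (pverts G) ^ 4) +
    10 * (class_edges G c i j * (\<Prod>k\<in>{..<5} - {i, j}. card (colour_class G c k))))"
    using card_pentagon_embeddings_le[OF G c U edges arc] by (simp only: of_nat_le_iff)
  also have "\<dots> = 5 * (card U * n ^ 4) + 10 * (class_edges G c i j * ?P)"
    by (simp add: n(1))
  finally have "card (embeddings cycle5 G) / n ^ 5 \<le>
      (5 * (card U * n ^ 4) + 10 * (class_edges G c i j * ?P)) / n ^ 5"
    using n(2) by (intro divide_right_mono) auto
  also have "\<dots> = 5 * (card U / n) + 10 * (class_edges G c i j / n ^ 2 * (?P / n ^ 3))"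
    using n(2) by (simp add: field_simps eval_nat_numeral)
  also have "?P / n ^ 3 = (\<Prod>k\<in>{..<5} - {i, j}. card (colour_class G c k) / n)"
    using card_minus_arc(1)[OF arc] by (simp add: prod_dividef)
  finally show ?thesis .
qed

lemma class_edges_le:
  "finite (pverts G) \<Longrightarrow> class_edges G c i j \<le> card (colour_class G c i) * card (colour_class G c j)"
  unfolding class_edges_def card_cartesian_product[symmetric]
  by (intro card_mono) (auto simp: colour_class_def)

text \<open>A random map into five equal classes has a valid colour pattern with probability
  \<open>card (colourings H) / 5 ^ card (pverts H)\<close>; the factor h!/|Aut(H)| passes from
  labelled to induced copies.\<close>

definition pentagon_limit :: "'b pair_pre_digraph \<Rightarrow> real" where
  "pentagon_limit H = card (colourings H) / 5 ^ card (pverts H) * fact (card (pverts H)) / card (embeddings H H)"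

lemma pentagon_limit_cycle5: "pentagon_limit cycle5 = fact 5 / 5 ^ 5"
  by (simp add: pentagon_limit_def colourings_cycle5 card_automorphisms_cycle5 pverts_cycle5_lessThan)

text \<open>The exceptional set consists of the vertices unattached to a well chosen pentagon. With
  d the embedding density of the pentagon, the bound is 5 (1 - (625/2) d) / d, which vanishes at the
  extremal value d = 2/625.\<close>

lemma exists_good_colouring:
  assumes G: "pair_graph G" and tf: "triangle_free G" and N: "card (embeddings cycle5 G) > 0"
    and n: "n = real (card (pverts G))" "n > 0"
  shows "\<exists>c U. (\<forall>v. c v < 5) \<and> U \<subseteq> pverts G \<and>
    (\<forall>x\<in>pverts G - U. \<forall>y\<in>pverts G - U. (x, y) \<in> parcs G \<longrightarrow> (c x, c y) \<in> parcs cycle5) \<and>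
    card U / n \<le> 5 * (1 - 625 / 2 * (card (embeddings cycle5 G) / n ^ 5)) / (card (embeddings cycle5 G) / n ^ 5)"
proof -
  let ?V = "pverts G" and ?E = "\<lambda>u v. (u, v) \<in> parcs G"
  let ?N = "real (card (embeddings cycle5 G))" and ?b = "real (card (bad_paths ?V ?E))"
  have tri: "?E x y \<Longrightarrow> ?E y z \<Longrightarrow> \<not> ?E x z" for x y z by (rule triangle_freeD[OF G tf])
  have sym: "?E x y = ?E y x" for x y by (rule pair_graph_sym[OF G])
  have fin: "finite ?V" by (rule pair_graph_finite[OF G])
  have eqN: "card (pentagons ?V ?E) = card (embeddings cycle5 G)"
    by (rule card_embeddings_cycle5[OF G tf, symmetric])
  then have ne: "pentagons ?V ?E \<noteq> {}" using N by auto
  have "\<exists>p\<in>pentagons ?V ?E.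
      card (unattached ?V ?E p) * card (pentagons ?V ?E) \<le> 5 * (card (bad_paths ?V ?E) * card ?V)"
    by (rule ex_well_attached_pentagon[OF fin sym _ ne]) (rule tri)
  then obtain p where "card (unattached ?V ?E p) * card (pentagons ?V ?E) \<le> 5 * (card (bad_paths ?V ?E) * card ?V)"
    by blast
  then have "real (card (unattached ?V ?E p) * card (pentagons ?V ?E)) \<le> real (5 * (card (bad_paths ?V ?E) * card ?V))"
    by (simp only: of_nat_le_iff)
  then have p: "card (unattached ?V ?E p) * ?N \<le> 5 * (?b * n)"
    by (simp add: eqN n(1))
  have "7500 * card (pentagons ?V ?E) + 24 * card (bad_paths ?V ?E) \<le> 24 * card ?V ^ 5"
    by (rule pentagon_certificate[OF fin sym]) (rule tri)
  then have "real (7500 * card (pentagons ?V ?E) + 24 * card (bad_paths ?V ?E)) \<le> real (24 * card ?V ^ 5)"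
    by (simp only: of_nat_le_iff)
  \<comment> \<open>The certificate divided by 24; 625/2 = 7500/24 is the reciprocal of the extremal
    embedding density.\<close>
  then have b: "?b \<le> n ^ 5 - 625 / 2 * ?N" by (simp add: eqN n(1))
  have *: "card (unattached ?V ?E p) * ?N \<le> 5 * ((n ^ 5 - 625 / 2 * ?N) * n)"
    using p b n(2) by (meson mult_left_mono mult_right_mono order_trans less_imp_le zero_le_numeral)
  have small: "card (unattached ?V ?E p) / n \<le> 5 * (1 - 625 / 2 * (?N / n ^ 5)) / (?N / n ^ 5)"
  proof -
    have "5 * (1 - 625 / 2 * (?N / n ^ 5)) / (?N / n ^ 5) = 5 * (n ^ 5 - 625 / 2 * ?N) / ?N"
      using N n(2) by (simp add: field_simps)
    moreover have "card (unattached ?V ?E p) / n \<le> 5 * (n ^ 5 - 625 / 2 * ?N) / ?N"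
      using * N n(2) by (simp add: field_simps)
    ultimately show ?thesis by (simp only:)
  qed
  have arcs: "(corner_colour ?E p x, corner_colour ?E p y) \<in> parcs cycle5"
    if "x \<in> ?V - unattached ?V ?E p" "y \<in> ?V - unattached ?V ?E p" "(x, y) \<in> parcs G" for x y
  proof (rule corner_adjacent)
    show "corner ?E p x (corner_colour ?E p x)" "corner ?E p y (corner_colour ?E p y)"
      using that by (auto intro: corner_corner_colour)
    show "?E x y" by (rule that)
    show "\<not> ?E x z" if "?E x y" "?E y z" for x y z using that by (rule tri)
  qed
  show ?thesis
  proof (intro exI[of _ "corner_colour ?E p"] exI[of _ "unattached ?V ?E p"] conjI allI ballI impI)
    show "corner_colour ?E p v < 5" for v by (rule corner_colour_less)
    show "unattached ?V ?E p \<subseteq> ?V" by (auto simp: unattached_def)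
  qed (fact arcs small)+
qed

text \<open>The pentagon count is squeezed twice. Bounding edges by products of class sizes forces
  the sizes to n/5; with the sizes known, the same count bounds the missing edges between each
  consecutive pair of classes.\<close>

lemma extremal_induced_density_tendsto:
  fixes G :: "nat \<Rightarrow> 'a pair_pre_digraph"
  assumes G: "\<And>n. pair_graph (G n)" and tf: "\<And>n. triangle_free (G n)"
    and inf: "filterlim (\<lambda>n. card (pverts (G n))) at_top sequentially"
    and C5: "(\<lambda>n. induced_density cycle5 (G n)) \<longlonglongrightarrow> fact 5 / 5 ^ 5"
    and H: "pair_graph H"
  shows "(\<lambda>n. induced_density H (G n)) \<longlonglongrightarrow> pentagon_limit H"
proof -
  define m where "m n = real (card (pverts (G n)))" for n
  define d where "d n = card (embeddings cycle5 (G n)) / m n ^ 5" for n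
  \<comment> \<open>The size bound is conditional so that a choice exists for every n: where
    \<open>m n\<close> or \<open>d n\<close> vanishes, U can be the whole vertex set, and then the
    edge condition is vacuous.\<close>
  define P where "P n c U \<longleftrightarrow> (\<forall>v. c v < 5) \<and> U \<subseteq> pverts (G n) \<and>
    (\<forall>x\<in>pverts (G n) - U. \<forall>y\<in>pverts (G n) - U. (x, y) \<in> parcs (G n) \<longrightarrow> (c x, c y) \<in> parcs cycle5) \<and>
    (m n > 0 \<and> d n > 0 \<longrightarrow> card U / m n \<le> 5 * (1 - 625 / 2 * d n) / d n)" for n and c :: "'a \<Rightarrow> nat" and U
  have "\<exists>c U. P n c U" for n
  proof (cases "m n > 0 \<and> d n > 0")
    case True
    then have "card (embeddings cycle5 (G n)) > 0" by (auto simp: d_def intro: gr0I)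
    then show ?thesis
      using exists_good_colouring[OF G tf _ m_def[of n]] True unfolding P_def d_def by blast
  next
    case False
    then show ?thesis unfolding P_def by (intro exI[of _ "\<lambda>_. 0"] exI[of _ "pverts (G n)"]) auto
  qed
  then obtain c U where PU: "\<And>n. P n (c n) (U n)" by metis
  have c: "c n v < 5" for n v using PU[of n] by (simp add: P_def)
  have U: "U n \<subseteq> pverts (G n)" for n using PU[of n] by (simp add: P_def)
  have edges: "(c n x, c n y) \<in> parcs cycle5"
    if "x \<in> pverts (G n) - U n" "y \<in> pverts (G n) - U n" "(x, y) \<in> parcs (G n)" for n x y
    using PU[of n] that unfolding P_def by blast
  have Ule: "card (U n) / m n \<le> 5 * (1 - 625 / 2 * d n) / d n" if "m n > 0" "d n > 0" for n
    using PU[of n] that unfolding P_def by blast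
  define x where "x n i = card (colour_class (G n) (c n) i) / m n" for n i
  define a where "a n = card (U n) / m n" for n
  define e where "e n i j = class_edges (G n) (c n) i j / m n ^ 2" for n i j
  \<comment> \<open>The embedding density is 2/625 = 10/5^5, since (2/625) * 5! / 10 =
    5!/5^5.\<close>
  have "(\<lambda>n. induced_density cycle5 (G n)) \<longlonglongrightarrow> 2 / 625 * fact (card (pverts cycle5)) / card (embeddings cycle5 cycle5)"
    using C5 by (simp add: card_automorphisms_cycle5 pverts_cycle5_lessThan fact_numeral)
  then have d: "d \<longlonglongrightarrow> 2 / 625"
    unfolding d_def m_def
    using embeddings_density_tendsto_iff[OF G pair_graph_cycle5 inf, of "2 / 625"]
    by (simp add: pverts_cycle5_lessThan)
  have ev: "\<forall>\<^sub>F n in sequentially. m n > 0 \<and> d n > 0"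
  proof (rule eventually_conj)
    show "\<forall>\<^sub>F n in sequentially. m n > 0"
      using eventually_gt_of_filterlim_at_top[OF inf, of 0] by (simp add: m_def)
    show "\<forall>\<^sub>F n in sequentially. d n > 0"
      using d by (rule order_tendstoD) simp
  qed
  have a: "a \<longlonglongrightarrow> 0"
  proof (rule tendsto_sandwich)
    show "\<forall>\<^sub>F n in sequentially. 0 \<le> a n" by (simp add: a_def m_def)
    show "\<forall>\<^sub>F n in sequentially. a n \<le> 5 * (1 - 625 / 2 * d n) / d n"
      using ev unfolding a_def by eventually_elim (rule Ule; simp)
    have "(\<lambda>n. 5 * (1 - 625 / 2 * d n) / d n) \<longlonglongrightarrow> 5 * (1 - 625 / 2 * (2 / 625)) / (2 / 625)"
      by (rule tendsto_divide[OF tendsto_mult[OF tendsto_const tendsto_diff[OF tendsto_const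
            tendsto_mult[OF tendsto_const d]]] d]) simp
    then show "(\<lambda>n. 5 * (1 - 625 / 2 * d n) / d n) \<longlonglongrightarrow> 0" by simp
  qed simp
  have x0: "0 \<le> x n i" for n i by (simp add: x_def m_def)
  have bound: "d n \<le> 5 * a n + 10 * (e n i j * (\<Prod>k\<in>{..<5} - {i, j}. x n k))"
    if "(i, j) \<in> parcs cycle5" "m n > 0" for n i j
    using pentagon_density_bound[OF G c U edges that(1) m_def that(2)]
    unfolding d_def a_def e_def x_def by simp
  have e_le: "e n i j \<le> x n i * x n j" for n i j
  proof -
    have "real (class_edges (G n) (c n) i j) \<le> real (card (colour_class (G n) (c n) i) * card (colour_class (G n) (c n) j))"
      using class_edges_le[OF pair_graph_finite[OF G]] by (simp only: of_nat_le_iff)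
    then have "real (class_edges (G n) (c n) i j) / m n ^ 2 \<le>
        real (card (colour_class (G n) (c n) i) * card (colour_class (G n) (c n) j)) / m n ^ 2"
      by (intro divide_right_mono) auto
    then show ?thesis by (simp add: e_def x_def power2_eq_square)
  qed
  have split: "(\<Prod>k<5. x n k) = x n i * x n j * (\<Prod>k\<in>{..<5} - {i, j}. x n k)"
    if "(i, j) \<in> parcs cycle5" for n i j
  proof -
    have "(\<Prod>k<5. x n k) = (\<Prod>k\<in>{..<5} - {i, j}. x n k) * (\<Prod>k\<in>{i, j}. x n k)"
      using card_minus_arc(2,3)[OF that] by (intro prod.subset_diff) auto
    then show ?thesis using card_minus_arc(4)[OF that] by simp
  qed
  have x: "(\<lambda>n. x n i) \<longlonglongrightarrow> 1 / 5" if i: "i < 5" for i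
  proof -
    have arc: "(0, 1) \<in> parcs cycle5" by (simp add: cycle5_arcs)
    \<comment> \<open>The constant 200 is 2000/10: the deficit from
      \<open>class_product_bound\<close> is multiplied by the ten automorphisms, and 2/625 =
      10/5^5.\<close>
    have up: "\<forall>\<^sub>F n in sequentially. (x n i - 1 / 5)\<^sup>2 \<le> 200 * (5 * a n + 2 / 625 - d n)"
      using ev
    proof eventually_elim
      case (elim n)
      have "d n \<le> 5 * a n + 10 * (e n 0 1 * (\<Prod>k\<in>{..<5} - {0, 1}. x n k))"
        using bound[OF arc] elim by blast
      also have "e n 0 1 * (\<Prod>k\<in>{..<5} - {0, 1}. x n k) \<le> (\<Prod>k<5. x n k)"
        unfolding split[OF arc] by (intro mult_right_mono e_le prod_nonneg) (simp add: x0)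
      also have "(\<Prod>k<5. x n k) \<le> 1 / 5 ^ 5 - (x n i - 1 / 5)\<^sup>2 / 2000"
      proof (rule class_product_bound[OF x0 _ i])
        show "(\<Sum>i<5. x n i) = 1"
          using sum_class_fractions[of "G n" "c n"] pair_graph_finite[OF G] c elim
          by (simp add: x_def m_def)
      qed
      finally show ?case by simp
    qed
    have "(\<lambda>n. 200 * (5 * a n + 2 / 625 - d n)) \<longlonglongrightarrow> 200 * (5 * 0 + 2 / 625 - 2 / 625)"
      by (intro tendsto_intros a d)
    then have lim: "(\<lambda>n. 200 * (5 * a n + 2 / 625 - d n)) \<longlonglongrightarrow> 0" by simp
    have "(\<lambda>n. (x n i - 1 / 5)\<^sup>2) \<longlonglongrightarrow> 0"
      by (rule tendsto_sandwich[OF _ up tendsto_const lim]) simp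
    then have "(\<lambda>n. x n i - 1 / 5) \<longlonglongrightarrow> 0" by simp
    then show ?thesis by (simp add: LIM_zero_iff)
  qed
  \<comment> \<open>Solving the pentagon bound for the missing density
    \<open>x n i * x n j - e n i j\<close> gives these quotients. Their numerators tend to 10/5^5 -
    2/625 = 0, while the denominators tend to 10/5^3.\<close>
  define W where "W n = 2 * a n + (\<Sum>(i, j)\<in>parcs cycle5.
      (5 * a n + 10 * (\<Prod>k<5. x n k) - d n) / (10 * (\<Prod>k\<in>{..<5} - {i, j}. x n k)))" for n
  have Wlim: "W \<longlonglongrightarrow> 2 * 0 + (\<Sum>(i, j)\<in>parcs cycle5.
      (5 * 0 + 10 * (\<Prod>k<5::nat. 1 / 5) - 2 / 625) / (10 * (\<Prod>k\<in>{..<5::nat} - {i, j}. 1 / 5)))"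
    unfolding W_def case_prod_unfold
    by (intro tendsto_intros a d x) (auto simp: prod_zero_iff)
  then have W: "W \<longlonglongrightarrow> 0" by (simp add: power_one_over)
  have xpos: "\<forall>\<^sub>F n in sequentially. \<forall>i\<in>{..<5}. x n i > 0"
    by (intro eventually_ball_finite ballI order_tendstoD(1)[OF x]) auto
  have wrong: "(\<lambda>n. card (wrong_pairs (G n) (c n)) / m n ^ 2) \<longlonglongrightarrow> 0"
  proof (rule tendsto_sandwich[OF _ _ tendsto_const W])
    show "\<forall>\<^sub>F n in sequentially. 0 \<le> card (wrong_pairs (G n) (c n)) / m n ^ 2" by simp
    show "\<forall>\<^sub>F n in sequentially. card (wrong_pairs (G n) (c n)) / m n ^ 2 \<le> W n"
      using ev xpos
    proof eventually_elim
      case (elim n)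
      have "card (wrong_pairs (G n) (c n)) / m n ^ 2 \<le> (2 * (real (card (U n)) * card (pverts (G n))) +
        (\<Sum>(i, j)\<in>parcs cycle5. real (card (colour_class (G n) (c n) i)) * card (colour_class (G n) (c n) j)
          - class_edges (G n) (c n) i j)) / m n ^ 2"
        using card_wrong_pairs_le[OF G c U edges] by (intro divide_right_mono) auto
      also have "\<dots> = 2 * a n + (\<Sum>(i, j)\<in>parcs cycle5. x n i * x n j - e n i j)"
        using elim(1)
        by (simp add: add_divide_distrib sum_divide_distrib diff_divide_distrib case_prod_unfold
            a_def x_def e_def power2_eq_square flip: m_def)
      also have "\<dots> \<le> W n"
        unfolding W_def
      proof (intro add_left_mono sum_mono, clarify)
        fix i j assume arc: "(i, j) \<in> parcs cycle5"
        let ?P = "\<Prod>k\<in>{..<5} - {i, j}. x n k"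
        have P: "?P > 0" using elim(2) by (intro prod_pos) auto
        have "(x n i * x n j - e n i j) * (10 * ?P) \<le> 5 * a n + 10 * (\<Prod>k<5. x n k) - d n"
          using bound[OF arc, of n] elim(1) unfolding split[OF arc] by (simp add: algebra_simps)
        then show "x n i * x n j - e n i j \<le> (5 * a n + 10 * (\<Prod>k<5. x n k) - d n) / (10 * ?P)"
          using P by (simp add: pos_le_divide_eq)
      qed
      finally show ?case .
    qed
  qed
  show ?thesis
    unfolding pentagon_limit_def
    by (rule coloured_induced_density_tendsto[OF G H c inf])
      (use x wrong in \<open>simp_all add: x_def m_def\<close>)
qed

section \<open>Uniqueness\<close>

lemma pair_graph_blowup_cycle5: "pair_graph (blowup cycle5 k)"
proof (rule pair_graphI)
  show "finite (pverts (blowup cycle5 k))" by (simp add: blowup_def cycle5_def)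
  show "u \<in> pverts (blowup cycle5 k) \<and> v \<in> pverts (blowup cycle5 k)" if "(u, v) \<in> parcs (blowup cycle5 k)" for u v
    using that pair_graph_arcD[OF pair_graph_cycle5] by (auto simp: blowup_def)
  show "(v, u) \<in> parcs (blowup cycle5 k)" if "(u, v) \<in> parcs (blowup cycle5 k)" for u v
    using that pair_graph_sym[OF pair_graph_cycle5] by (auto simp: blowup_def)
  show "(u, u) \<notin> parcs (blowup cycle5 k)" for u
    by (auto simp: blowup_def)
qed

text \<open>The defect-free case: no wrong pairs and classes of exactly equal size. It is stated for
  any vertex type because two models of the blow-up are used below.\<close>

lemma exactly_coloured_density_tendsto:
  fixes G :: "nat \<Rightarrow> 'a pair_pre_digraph" and c :: "'a \<Rightarrow> nat"
  assumes G: "\<And>k. pair_graph (G k)" and H: "pair_graph H"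
    and c: "\<And>k v. v \<in> pverts (G k) \<Longrightarrow> c v < 5"
    and arcs: "\<And>k u v. u \<in> pverts (G k) \<Longrightarrow> v \<in> pverts (G k) \<Longrightarrow>
      (u, v) \<in> parcs (G k) \<longleftrightarrow> (c u, c v) \<in> parcs cycle5"
    and classes: "\<And>k i. i < 5 \<Longrightarrow> card (colour_class (G k) c i) = k"
    and size: "\<And>k. card (pverts (G k)) = 5 * k"
  shows "(\<lambda>k. induced_density H (G k)) \<longlonglongrightarrow> pentagon_limit H"
  unfolding pentagon_limit_def
proof (rule coloured_induced_density_tendsto[OF G H, where c = "\<lambda>_. c"])
  show "c v < 5" if "v \<in> pverts (G k)" for k v using c that .
  show "filterlim (\<lambda>k. card (pverts (G k))) at_top sequentially"
    unfolding size by (rule filterlim_subseq) (simp add: strict_mono_def)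
  have "\<forall>\<^sub>F k in sequentially. 1 / 5 = real k / real (5 * k)"
    using eventually_gt_at_top[of 0] by eventually_elim simp
  then show "(\<lambda>k. card (colour_class (G k) c i) / real (card (pverts (G k)))) \<longlonglongrightarrow> 1 / 5" if "i < 5" for i
    unfolding classes[OF that] size by (rule tendsto_eventually[OF eventually_mono]) simp
  have "wrong_pairs (G k) c = {}" for k
    using arcs by (auto simp: wrong_pairs_def)
  then show "(\<lambda>k. card (wrong_pairs (G k) c) / real (card (pverts (G k))) ^ 2) \<longlonglongrightarrow> 0" by simp
qed

lemma blowup_cycle5_density_tendsto:
  assumes "pair_graph H"
  shows "(\<lambda>k. induced_density H (blowup cycle5 k)) \<longlonglongrightarrow> pentagon_limit H"
proof (rule exactly_coloured_density_tendsto[OF pair_graph_blowup_cycle5 assms, where c = fst])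
  have V: "pverts (blowup cycle5 k) = {..<5} \<times> {1..k}" for k
    by (simp add: blowup_def cycle5_def)
  show "fst v < 5" if "v \<in> pverts (blowup cycle5 k)" for k v
    using that by (auto simp: V)
  show "(u, v) \<in> parcs (blowup cycle5 k) \<longleftrightarrow> (fst u, fst v) \<in> parcs cycle5"
    if "u \<in> pverts (blowup cycle5 k)" "v \<in> pverts (blowup cycle5 k)" for k u v
    using that pair_graph_irrefl[OF pair_graph_cycle5] unfolding V
    by (cases u; cases v) (auto simp: blowup_def)
  show "card (pverts (blowup cycle5 k)) = 5 * k" for k
    by (simp add: V card_cartesian_product)
  show "card (colour_class (blowup cycle5 k) fst i) = k" if "i < 5" for k i
  proof -
    have "colour_class (blowup cycle5 k) fst i = {i} \<times> {1..k}"
      using that by (auto simp: colour_class_def V)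
    then show ?thesis by (simp add: card_cartesian_product)
  qed
qed

text \<open>The balanced blow-up of the pentagon with natural numbers as vertices, class given by
  the residue modulo 5. Membership in \<open>tf_hom_plus\<close> asks for a sequence of graphs on
  \<open>nat\<close>, whereas \<open>blowup\<close> has pairs as vertices.\<close>

definition mod5_graph :: "nat \<Rightarrow> nat pair_pre_digraph" where
  "mod5_graph k = \<lparr>pverts = {..<5 * k},
     parcs = {(u, v). u < 5 * k \<and> v < 5 * k \<and> (u mod 5, v mod 5) \<in> parcs cycle5}\<rparr>"

lemma pair_graph_mod5_graph: "pair_graph (mod5_graph k)"
proof (rule pair_graphI)
  show "(v, u) \<in> parcs (mod5_graph k)" if "(u, v) \<in> parcs (mod5_graph k)" for u v
    using that pair_graph_sym[OF pair_graph_cycle5] by (auto simp: mod5_graph_def)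
  show "(u, u) \<notin> parcs (mod5_graph k)" for u
    using pair_graph_irrefl[OF pair_graph_cycle5] by (auto simp: mod5_graph_def)
qed (auto simp: mod5_graph_def)

lemma triangle_free_mod5_graph: "triangle_free (mod5_graph k)"
  unfolding triangle_free_def
proof clarify
  fix u v w
  assume "(u, v) \<in> parcs (mod5_graph k)" "(v, w) \<in> parcs (mod5_graph k)" "(w, u) \<in> parcs (mod5_graph k)"
  then have "(u mod 5, v mod 5) \<in> parcs cycle5" "(v mod 5, w mod 5) \<in> parcs cycle5"
    "(w mod 5, u mod 5) \<in> parcs cycle5"
    by (simp_all add: mod5_graph_def)
  then show False using triangle_free_cycle5 unfolding triangle_free_def by blast
qed

lemma mod5_graph_density_tendsto:
  assumes "pair_graph H"
  shows "(\<lambda>k. induced_density H (mod5_graph k)) \<longlonglongrightarrow> pentagon_limit H"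
proof (rule exactly_coloured_density_tendsto[OF pair_graph_mod5_graph assms, where c = "\<lambda>v. v mod 5"])
  show "card (colour_class (mod5_graph k) (\<lambda>v. v mod 5) i) = k" if i: "i < 5" for k i
  proof -
    have "colour_class (mod5_graph k) (\<lambda>v. v mod 5) i = (\<lambda>q. 5 * q + i) ` {..<k}"
    proof (intro set_eqI iffI)
      fix v assume "v \<in> colour_class (mod5_graph k) (\<lambda>v. v mod 5) i"
      then have v: "v < 5 * k" "v mod 5 = i" by (auto simp: colour_class_def mod5_graph_def)
      then have "v = 5 * (v div 5) + i" "v div 5 < k"
        using mult_div_mod_eq[of 5 v] by (simp_all add: less_mult_imp_div_less mult.commute)
      then show "v \<in> (\<lambda>q. 5 * q + i) ` {..<k}" by blast
    next
      fix v assume "v \<in> (\<lambda>q. 5 * q + i) ` {..<k}"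
      then obtain q where "v = 5 * q + i" "q < k" by blast
      then show "v \<in> colour_class (mod5_graph k) (\<lambda>v. v mod 5) i"
        using i by (simp add: colour_class_def mod5_graph_def)
    qed
    moreover have "inj_on (\<lambda>q. 5 * q + i) {..<k}" by (rule inj_onI) simp
    ultimately show ?thesis by (simp add: card_image)
  qed
qed (auto simp: mod5_graph_def)

lemma blowup_limit_cycle5:
  "pair_graph H \<Longrightarrow> blowup_limit cycle5 H = pentagon_limit H"
  by (simp add: blowup_limit_def blowup_cycle5_density_tendsto limI)

lemma extremal_limit_eq:
  assumes conv: "tf_converges_to G \<phi>" and C5: "\<phi> cycle5 = fact 5 / 5 ^ 5" and H: "pair_graph H"
  shows "\<phi> H = pentagon_limit H"
proof -
  have G: "\<And>n. pair_graph (G n)" "\<And>n. triangle_free (G n)"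
    and inf: "filterlim (\<lambda>n. card (pverts (G n))) at_top sequentially"
    and lim: "\<And>H. pair_graph H \<Longrightarrow> (\<lambda>n. induced_density H (G n)) \<longlonglongrightarrow> \<phi> H"
    using conv by (simp_all add: tf_converges_to_def)
  have "(\<lambda>n. induced_density cycle5 (G n)) \<longlonglongrightarrow> fact 5 / 5 ^ 5"
    using lim[OF pair_graph_cycle5] unfolding C5 .
  from extremal_induced_density_tendsto[OF G inf this H] lim[OF H]
  show ?thesis by (metis LIMSEQ_unique)
qed

theorem theorem3:
  "(\<forall>(G :: nat \<Rightarrow> 'a pair_pre_digraph) \<phi>.
      tf_converges_to G \<phi> \<and> \<phi> cycle5 = fact 5 / 5 ^ 5 \<longrightarrow>
      (\<forall>H. pair_graph H \<longrightarrow> (\<lambda>k. induced_density H (blowup cycle5 k)) \<longlonglongrightarrow> \<phi> H)) \<and>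
   (blowup_limit cycle5 \<in> tf_hom_plus \<and>
    blowup_limit cycle5 cycle5 = fact 5 / 5 ^ 5 \<and>
    (\<forall>\<phi> \<in> tf_hom_plus. \<phi> cycle5 = fact 5 / 5 ^ 5 \<longrightarrow> \<phi> = blowup_limit cycle5))"
proof (intro conjI allI impI ballI)
  fix G :: "nat \<Rightarrow> 'a pair_pre_digraph" and \<phi> and H :: "nat pair_pre_digraph"
  assume "tf_converges_to G \<phi> \<and> \<phi> cycle5 = fact 5 / 5 ^ 5" "pair_graph H"
  then have "\<phi> H = pentagon_limit H" using extremal_limit_eq by blast
  then show "(\<lambda>k. induced_density H (blowup cycle5 k)) \<longlonglongrightarrow> \<phi> H"
    using blowup_cycle5_density_tendsto[OF \<open>pair_graph H\<close>] by simp
next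
  have "filterlim (\<lambda>k. card (pverts (mod5_graph k))) at_top sequentially"
    unfolding mod5_graph_def by (simp, rule filterlim_subseq) (simp add: strict_mono_def)
  then have "tf_converges_to mod5_graph (blowup_limit cycle5)"
    by (simp add: tf_converges_to_def pair_graph_mod5_graph triangle_free_mod5_graph
        mod5_graph_density_tendsto blowup_limit_cycle5)
  moreover have "blowup_limit cycle5 \<in> extensional (Collect pair_graph)"
    by (simp add: blowup_limit_def)
  ultimately show "blowup_limit cycle5 \<in> tf_hom_plus"
    unfolding tf_hom_plus_def by blast
next
  show "blowup_limit cycle5 cycle5 = fact 5 / 5 ^ 5"
    using blowup_limit_cycle5[OF pair_graph_cycle5] pentagon_limit_cycle5 by simp
next
  fix \<phi> assume \<phi>: "\<phi> \<in> tf_hom_plus" "\<phi> cycle5 = fact 5 / 5 ^ 5"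
  then obtain G :: "nat \<Rightarrow> nat pair_pre_digraph" where G: "tf_converges_to G \<phi>"
    by (auto simp: tf_hom_plus_def)
  show "\<phi> = blowup_limit cycle5"
  proof (rule extensionalityI[of _ "Collect pair_graph"])
    show "\<phi> \<in> extensional (Collect pair_graph)" using \<phi> by (simp add: tf_hom_plus_def)
    show "blowup_limit cycle5 \<in> extensional (Collect pair_graph)" by (simp add: blowup_limit_def)
    show "\<phi> H = blowup_limit cycle5 H" if "H \<in> Collect pair_graph" for H
      using that extremal_limit_eq[OF G \<phi>(2)] blowup_limit_cycle5 by simp
  qed
qed

end
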